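(* Let $\Gamma$ be a simply-laced graph, $\pi$ an admissible involutive automorphism of $\Gamma$, and $\sigma:\Gamma^\pi\to\{1,-1\}$ a choice of signs on the set of $\pi$-stable vertices. Then $$\Delta(\Gamma_{\pi,\sigma})_+=\overline{\Delta(\Gamma)_+}=\{\overline{\alpha}\mid \alpha\in\Delta(\Gamma)_+\}.$$
   Context: $\Gamma$ is a finite graph without loops or multiple edges, with vertex set $\Gamma_0$; $\pi$ is an automorphism with $\pi^2=1$; $\pi$ is admissible if no edge of $\Gamma$ is $\pi$-stable. $\Gamma^\pi$ is the set of $\pi$-fixed vertices and $\sigma(i)=\pm1$ is fixed for $i\in\Gamma^\pi$. Write $\overline{i}$ for the $\pi$-orbit of a vertex $i$. Root system of $\Gamma$: $Q(\Gamma)=\mathbf{Z}^{\Gamma_0}$ with standard basis $\varepsilon_i$ (simple roots), $Q(\Gamma)_+=\mathbf{Z}_+^{\Gamma_0}$, and the symmetric bilinear form $\langle\varepsilon_i,\varepsilon_i\rangle=1$, $\langle\varepsilon_i,\varepsilon_j\rangle=-\frac12$ if $i,j$ are adjacent, $0$ otherwise for $i\neq j$. $W(\Gamma)$ is generated by $r_i(\alpha)=\alpha-2\langle\alpha,\varepsilon_i\rangle\varepsilon_i$. $\Delta(\Gamma)_+$ is the set of positive roots: real ones $W(\Gamma)\{\varepsilon_i\}\cap Q(\Gamma)_+$, and imaginary ones $W(\Gamma)F_\Gamma$, where $F_\Gamma$ is the set of nonzero $\alpha\in Q(\Gamma)_+$ with connected support and $\langle\alpha,\varepsilon_i\rangle\le0$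 for all $i$. Sublattice: $Q(\Gamma)_{\pi,\sigma}=\{\alpha\in Q(\Gamma)\mid\alpha_{\pi(i)}=\alpha_i \text{ for all } i,\ \sigma(j)^{\alpha_j}=1\text{ for } j\in\Gamma^\pi\}$ (symmetric vectors, even at the vertices with sign $-1$). It has basis $\Pi_{\pi,\sigma}=\{\beta_{\overline{i}}\}$, where $\beta_{\overline i}=\varepsilon_i+\varepsilon_{\pi(i)}$ if $i\notin\Gamma^\pi$, $\beta_{\overline i}=\varepsilon_i$ if $\sigma(i)=1$, $\beta_{\overline i}=2\varepsilon_i$ if $\sigma(i)=-1$. For $\alpha\in Q(\Gamma)$ put $\overline\alpha=\alpha$ if $\alpha\in Q(\Gamma)_{\pi,\sigma}$ and $\overline\alpha=\alpha+\pi(\alpha)$ otherwise. Graph $\Gamma_{\pi,\sigma}$: vertices are the $\pi$-orbits of vertices of $\Gamma$. Each $\pi$-orbit of edges of $\Gamma$ contributes: for an edge between $i,j\notin\Gamma^\pi$, a simple edge between $\overline i$ and $\overline j$; for an edge between $i\notin\Gamma^\pi$ and $j\in\Gamma^\pi$, a double edge between $\overline i$ and $\overline j$, oriented to $\overline j$ if $\sigma(j)=1$ and from $\overline j$ if $\sigma(j)=-1$. Its generalized Cartan matrix $A$ has $A_{ii}=2$, $A_{ij}=0$ for non-adjacent $i\ne j$, $A_{ij}=A_{ji}=-(\text{number of simple edges})$ for simple edges, and $A_{ij}=-1$, $A_{ji}=-2$ for $i\Rightarrow j$. $\Delta(\Gamma_{\pi,\sigma})_+$ is the set of positive roots (real and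 imaginary) of the Kac–Moody root system of $A$, regarded as a subset of $Q(\Gamma)_{\pi,\sigma}$ by identifying the simple roots with the $\beta_{\overline i}$, the simple reflections being $s_{\overline i}(\beta_{\overline j})=\beta_{\overline j}-A_{\overline i\,\overline j}\beta_{\overline i}$. *)

theory Defs
  imports Complex_Main "HOL-Library.Poly_Mapping"
begin

section \<open>Graphs with an involution\<close>

definition simple_graph :: "'a set \<Rightarrow> 'a set set \<Rightarrow> bool" where
  "simple_graph V E \<longleftrightarrow> finite V \<and> (\<forall>e\<in>E. \<exists>u\<in>V. \<exists>v\<in>V. u \<noteq> v \<and> e = {u, v})"

definition graph_automorphism :: "'a set \<Rightarrow> 'a set set \<Rightarrow> ('a \<Rightarrow> 'a) \<Rightarrow> bool" where
  "graph_automorphism V E \<pi> \<longleftrightarrow>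
     bij_betw \<pi> V V \<and> (\<forall>u\<in>V. \<forall>v\<in>V. {u, v} \<in> E \<longleftrightarrow> {\<pi> u, \<pi> v} \<in> E)"

definition involutive_on :: "'a set \<Rightarrow> ('a \<Rightarrow> 'a) \<Rightarrow> bool" where
  "involutive_on V \<pi> \<longleftrightarrow> (\<forall>i\<in>V. \<pi> (\<pi> i) = i)"

definition admissible :: "'a set set \<Rightarrow> ('a \<Rightarrow> 'a) \<Rightarrow> bool" where
  "admissible E \<pi> \<longleftrightarrow> (\<forall>e\<in>E. \<pi> ` e \<noteq> e)"

definition fixed_vertices :: "'a set \<Rightarrow> ('a \<Rightarrow> 'a) \<Rightarrow> 'a set" where
  "fixed_vertices V \<pi> = {i \<in> V. \<pi> i = i}"

definition vorbit :: "('a \<Rightarrow> 'a) \<Rightarrow> 'a \<Rightarrow> 'a set" where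
  "vorbit \<pi> i = {i, \<pi> i}"

definition edge_orbits :: "'a set set \<Rightarrow> ('a \<Rightarrow> 'a) \<Rightarrow> 'a set set set" where
  "edge_orbits E \<pi> = (\<lambda>e. {e, \<pi> ` e}) ` E"


section \<open>Root lattices, reflection groups, connected supports\<close>

text \<open>The lattice \<open>\<int>\<^sup>V\<close> consists of the elements of the free abelian group on the
  vertex type whose support lies in \<open>V\<close>; \<open>frag_of i\<close> is the simple root at \<open>i\<close>.\<close>

definition root_lattice :: "'a set \<Rightarrow> ('a \<Rightarrow>\<^sub>0 int) set" where
  "root_lattice V = {\<alpha>. Poly_Mapping.keys \<alpha> \<subseteq> V}"

definition root_lattice_pos :: "'a set \<Rightarrow> ('a \<Rightarrow>\<^sub>0 int) set" where
  "root_lattice_pos V = {\<alpha> \<in> root_lattice V. \<forall>i\<in>V. 0 \<le> Poly_Mapping.lookup \<alpha> i}"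

text \<open>The monoid generated by a set of maps. It is only applied to sets of reflections,
  which are involutions, so that it is the group they generate.\<close>

inductive_set generated_by :: "('b \<Rightarrow> 'b) set \<Rightarrow> ('b \<Rightarrow> 'b) set" for S where
  id: "id \<in> generated_by S"
| comp: "s \<in> S \<Longrightarrow> w \<in> generated_by S \<Longrightarrow> s \<circ> w \<in> generated_by S"

definition connected_subset :: "('a \<Rightarrow> 'a \<Rightarrow> bool) \<Rightarrow> 'a set \<Rightarrow> bool" where
  "connected_subset adj S \<longleftrightarrow>
     (\<forall>u\<in>S. \<forall>v\<in>S. (u, v) \<in> {(x, y). x \<in> S \<and> y \<in> S \<and> adj x y}\<^sup>*)"


section \<open>The root system of a graph\<close>

definition gform :: "'a set \<Rightarrow> 'a set set \<Rightarrow> ('a \<Rightarrow>\<^sub>0 int) \<Rightarrow> ('a \<Rightarrow>\<^sub>0 int) \<Rightarrow> rat" where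
  "gform V E \<alpha> \<gamma> = (\<Sum>i\<in>V. \<Sum>j\<in>V. of_int (Poly_Mapping.lookup \<alpha> i) * of_int (Poly_Mapping.lookup \<gamma> j) *
     (if i = j then 1 else if {i, j} \<in> E then - 1 / 2 else 0))"

text \<open>The scalar \<open>2\<langle>\<alpha>, \<epsilon>\<^sub>i\<rangle>\<close> is an integer (lemma \<open>of_int_floor_gform\<close> below), so
  taking the floor only converts its type.\<close>

definition greflection :: "'a set \<Rightarrow> 'a set set \<Rightarrow> 'a \<Rightarrow> ('a \<Rightarrow>\<^sub>0 int) \<Rightarrow> ('a \<Rightarrow>\<^sub>0 int)" where
  "greflection V E i \<alpha> = \<alpha> - frag_cmul \<lfloor>2 * gform V E \<alpha> (frag_of i)\<rfloor> (frag_of i)"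

lemma of_int_floor_gform:
  "of_int \<lfloor>2 * gform V E \<alpha> (frag_of i)\<rfloor> = 2 * gform V E \<alpha> (frag_of i)"
proof -
  have "2 * gform V E \<alpha> (frag_of i) = (\<Sum>k\<in>V. \<Sum>j\<in>V. of_int (Poly_Mapping.lookup \<alpha> k * Poly_Mapping.lookup (frag_of i) j *
     (if k = j then 2 else if {k, j} \<in> E then - 1 else 0)))"
    unfolding gform_def sum_distrib_left by (intro sum.cong refl) auto
  also have "\<dots> \<in> \<int>"
    by (intro Ints_sum Ints_of_int)
  finally show ?thesis
    by (simp add: of_int_floor)
qed

definition gweyl :: "'a set \<Rightarrow> 'a set set \<Rightarrow> (('a \<Rightarrow>\<^sub>0 int) \<Rightarrow> ('a \<Rightarrow>\<^sub>0 int)) set" where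
  "gweyl V E = generated_by (greflection V E ` V)"

definition gfundamental :: "'a set \<Rightarrow> 'a set set \<Rightarrow> ('a \<Rightarrow>\<^sub>0 int) set" where
  "gfundamental V E = {\<alpha> \<in> root_lattice_pos V. \<alpha> \<noteq> 0 \<and>
     connected_subset (\<lambda>u v. {u, v} \<in> E) (Poly_Mapping.keys \<alpha>) \<and>
     (\<forall>i\<in>V. gform V E \<alpha> (frag_of i) \<le> 0)}"

definition gpos_roots :: "'a set \<Rightarrow> 'a set set \<Rightarrow> ('a \<Rightarrow>\<^sub>0 int) set" where
  "gpos_roots V E =
     {w (frag_of i) | w i. w \<in> gweyl V E \<and> i \<in> V} \<inter> root_lattice_pos V \<union>
     {w \<alpha> | w \<alpha>. w \<in> gweyl V E \<and> \<alpha> \<in> gfundamental V E}"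


section \<open>The root system of a generalized Cartan matrix\<close>

text \<open>Here \<open>I\<close> is the index set, \<open>A\<close> the matrix, and \<open>\<Sum>j\<in>I. A i j * \<alpha>\<^sub>j\<close> is
  the pairing of \<open>\<alpha>\<close> with the simple coroot at \<open>i\<close>. The positive imaginary roots are the
  Weyl group translates of the nonzero positive vectors with connected support that pair
  nonpositively with all simple coroots.\<close>

definition coroot_pairing :: "'b set \<Rightarrow> ('b \<Rightarrow> 'b \<Rightarrow> int) \<Rightarrow> ('b \<Rightarrow>\<^sub>0 int) \<Rightarrow> 'b \<Rightarrow> int" where
  "coroot_pairing I A \<alpha> i = (\<Sum>j\<in>I. A i j * Poly_Mapping.lookup \<alpha> j)"

definition km_reflection ::
    "'b set \<Rightarrow> ('b \<Rightarrow> 'b \<Rightarrow> int) \<Rightarrow> 'b \<Rightarrow> ('b \<Rightarrow>\<^sub>0 int) \<Rightarrow> ('b \<Rightarrow>\<^sub>0 int)" where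
  "km_reflection I A i \<alpha> = \<alpha> - frag_cmul (coroot_pairing I A \<alpha> i) (frag_of i)"

definition km_weyl ::
    "'b set \<Rightarrow> ('b \<Rightarrow> 'b \<Rightarrow> int) \<Rightarrow> (('b \<Rightarrow>\<^sub>0 int) \<Rightarrow> ('b \<Rightarrow>\<^sub>0 int)) set" where
  "km_weyl I A = generated_by (km_reflection I A ` I)"

definition km_fundamental :: "'b set \<Rightarrow> ('b \<Rightarrow> 'b \<Rightarrow> int) \<Rightarrow> ('b \<Rightarrow>\<^sub>0 int) set" where
  "km_fundamental I A = {\<alpha> \<in> root_lattice_pos I. \<alpha> \<noteq> 0 \<and>
     connected_subset (\<lambda>i j. A i j \<noteq> 0) (Poly_Mapping.keys \<alpha>) \<and>
     (\<forall>i\<in>I. coroot_pairing I A \<alpha> i \<le> 0)}"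

definition km_pos_roots :: "'b set \<Rightarrow> ('b \<Rightarrow> 'b \<Rightarrow> int) \<Rightarrow> ('b \<Rightarrow>\<^sub>0 int) set" where
  "km_pos_roots I A =
     {w (frag_of i) | w i. w \<in> km_weyl I A \<and> i \<in> I} \<inter> root_lattice_pos I \<union>
     {w \<alpha> | w \<alpha>. w \<in> km_weyl I A \<and> \<alpha> \<in> km_fundamental I A}"


section \<open>The folded graph\<close>

text \<open>Vertices are the sets \<open>vorbit \<pi> i\<close>; an edge is represented by the edge orbit
  contributing it. \<open>double_edges V E \<pi> \<sigma> I J\<close> are the double edges \<open>I \<Rightarrow> J\<close>.\<close>

definition simple_edges :: "'a set \<Rightarrow> 'a set set \<Rightarrow> ('a \<Rightarrow> 'a) \<Rightarrow> 'a set \<Rightarrow> 'a set \<Rightarrow> 'a set set set" where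
  "simple_edges V E \<pi> I J = {c \<in> edge_orbits E \<pi>.
     \<exists>i \<in> V - fixed_vertices V \<pi>. \<exists>j \<in> V - fixed_vertices V \<pi>.
       {i, j} \<in> c \<and> I = vorbit \<pi> i \<and> J = vorbit \<pi> j}"

definition double_edges ::
    "'a set \<Rightarrow> 'a set set \<Rightarrow> ('a \<Rightarrow> 'a) \<Rightarrow> ('a \<Rightarrow> int) \<Rightarrow> 'a set \<Rightarrow> 'a set \<Rightarrow> 'a set set set" where
  "double_edges V E \<pi> \<sigma> I J = {c \<in> edge_orbits E \<pi>.
     \<exists>i \<in> V - fixed_vertices V \<pi>. \<exists>j \<in> fixed_vertices V \<pi>. {i, j} \<in> c \<and>
       (\<sigma> j = 1 \<and> I = vorbit \<pi> i \<and> J = vorbit \<pi> j \<or>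
        \<sigma> j = -1 \<and> I = vorbit \<pi> j \<and> J = vorbit \<pi> i)}"

definition folded_cartan ::
    "'a set \<Rightarrow> 'a set set \<Rightarrow> ('a \<Rightarrow> 'a) \<Rightarrow> ('a \<Rightarrow> int) \<Rightarrow> 'a set \<Rightarrow> 'a set \<Rightarrow> int" where
  "folded_cartan V E \<pi> \<sigma> I J =
     (if I = J then 2
      else if double_edges V E \<pi> \<sigma> I J \<noteq> {} then -1
      else if double_edges V E \<pi> \<sigma> J I \<noteq> {} then -2
      else - int (card (simple_edges V E \<pi> I J)))"


section \<open>The symmetric sublattice\<close>

definition act :: "('a \<Rightarrow> 'a) \<Rightarrow> ('a \<Rightarrow>\<^sub>0 int) \<Rightarrow> ('a \<Rightarrow>\<^sub>0 int)" where
  "act \<pi> = frag_extend (\<lambda>i. frag_of (\<pi> i))"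

definition sym_lattice :: "'a set \<Rightarrow> ('a \<Rightarrow> 'a) \<Rightarrow> ('a \<Rightarrow> int) \<Rightarrow> ('a \<Rightarrow>\<^sub>0 int) set" where
  "sym_lattice V \<pi> \<sigma> = {\<alpha> \<in> root_lattice V.
     (\<forall>i\<in>V. Poly_Mapping.lookup \<alpha> (\<pi> i) = Poly_Mapping.lookup \<alpha> i) \<and>
     (\<forall>j\<in>fixed_vertices V \<pi>. rat_of_int (\<sigma> j) powi Poly_Mapping.lookup \<alpha> j = 1)}"

definition vertex_beta :: "'a set \<Rightarrow> ('a \<Rightarrow> 'a) \<Rightarrow> ('a \<Rightarrow> int) \<Rightarrow> 'a \<Rightarrow> ('a \<Rightarrow>\<^sub>0 int)" where
  "vertex_beta V \<pi> \<sigma> i =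
     (if i \<notin> fixed_vertices V \<pi> then frag_of i + frag_of (\<pi> i)
      else if \<sigma> i = 1 then frag_of i
      else frag_cmul 2 (frag_of i))"

text \<open>For an involution \<open>\<pi>\<close> of \<open>V\<close>, \<open>vertex_beta\<close> is constant on orbits, so the choice of
  representative does not matter.\<close>

definition orbit_beta :: "'a set \<Rightarrow> ('a \<Rightarrow> 'a) \<Rightarrow> ('a \<Rightarrow> int) \<Rightarrow> 'a set \<Rightarrow> ('a \<Rightarrow>\<^sub>0 int)" where
  "orbit_beta V \<pi> \<sigma> I = vertex_beta V \<pi> \<sigma> (SOME i. i \<in> I)"

lemma orbit_beta_vorbit:
  assumes "\<pi> ` V \<subseteq> V" "involutive_on V \<pi>" "i \<in> V"
  shows "orbit_beta V \<pi> \<sigma> (vorbit \<pi> i) = vertex_beta V \<pi> \<sigma> i"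
proof -
  have "(SOME k. k \<in> vorbit \<pi> i) \<in> vorbit \<pi> i"
    by (rule someI[of _ i]) (simp add: vorbit_def)
  moreover have "vertex_beta V \<pi> \<sigma> (\<pi> i) = vertex_beta V \<pi> \<sigma> i"
    using assms by (auto simp: vertex_beta_def fixed_vertices_def involutive_on_def add.commute)
  ultimately show ?thesis
    by (auto simp: orbit_beta_def vorbit_def)
qed

text \<open>The positive roots of the folded graph, with the simple root at an orbit \<open>I\<close> identified
  with \<open>orbit_beta V \<pi> \<sigma> I\<close>; \<open>frag_extend\<close> is the linear extension of this identification.\<close>

definition folded_pos_roots ::
    "'a set \<Rightarrow> 'a set set \<Rightarrow> ('a \<Rightarrow> 'a) \<Rightarrow> ('a \<Rightarrow> int) \<Rightarrow> ('a \<Rightarrow>\<^sub>0 int) set" where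
  "folded_pos_roots V E \<pi> \<sigma> =
     frag_extend (orbit_beta V \<pi> \<sigma>) ` km_pos_roots (vorbit \<pi> ` V) (folded_cartan V E \<pi> \<sigma>)"

definition symmetrize :: "'a set \<Rightarrow> ('a \<Rightarrow> 'a) \<Rightarrow> ('a \<Rightarrow> int) \<Rightarrow> ('a \<Rightarrow>\<^sub>0 int) \<Rightarrow> ('a \<Rightarrow>\<^sub>0 int)" where
  "symmetrize V \<pi> \<sigma> \<alpha> = (if \<alpha> \<in> sym_lattice V \<pi> \<sigma> then \<alpha> else \<alpha> + act \<pi> \<alpha>)"

end

theory Submission
  imports Defs
begin

text \<open>Write \<open>s\<^sub>i\<close> for \<open>r\<^sub>i\<close> if \<open>\<pi>\<close> fixes \<open>i\<close> and for \<open>r\<^sub>i r\<^bsub>\<pi> i\<^esub>\<close> otherwise; the two factors commute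
  because \<open>i\<close> and \<open>\<pi> i\<close> are not adjacent. Identifying the simple roots of the folded graph with
  the vectors \<open>\<beta>\<close> turns its simple reflections into the maps \<open>s\<^sub>i\<close>, restricted to the symmetric
  sublattice (\<open>phi_km_reflection\<close>). This is a computation with the Cartan matrix: up to the factor
  \<open>mult i\<close>, a row of it counts the neighbours of \<open>i\<close> in each orbit (\<open>cartan_row\<close>). Moreover \<open>s\<^sub>i\<close>
  commutes with \<open>\<pi>\<close> and preserves the sublattice, so it commutes with \<open>\<alpha> \<mapsto> bar \<alpha>\<close>
  (\<open>bar_s\<close>). Both sides of the claim are therefore compatible with the group generated by the
  \<open>s\<^sub>i\<close>, and what remains is to compare representatives of its orbits.

  From folded roots to roots of the graph (\<open>phi_root_is_bar\<close>): the vector \<open>\<beta>\<close> of the orbit of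
  \<open>i\<close> is \<open>bar \<epsilon>\<^sub>i\<close>, so a real folded root is \<open>bar (w \<epsilon>\<^sub>i)\<close>, where \<open>w \<epsilon>\<^sub>i\<close> has a constant sign,
  which is that of its \<open>bar\<close>. For a fundamental vector of the folded graph, the support in the original
  graph is either connected or consists of two components exchanged by \<open>\<pi>\<close>; the restriction to
  one component is fundamental and its \<open>bar\<close> is the given vector (\<open>fundamental_phi_bar\<close>).

  From roots of the graph to folded roots (\<open>bar_root_is_phi\<close>): induction on the height of a
  positive root \<open>\<alpha>\<close>. If \<open>\<alpha> + \<pi> \<alpha>\<close> pairs nonpositively with every \<open>\<epsilon>\<^sub>i\<close>, then \<open>bar \<alpha>\<close> is
  fundamental for the folded graph, because positive roots have connected support. Otherwise some
  \<open>s\<^sub>i\<close> lowers the height of \<open>\<alpha>\<close> and keeps it a positive root, unless \<open>\<alpha>\<close> is \<open>\<epsilon>\<^sub>i\<close> or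
  \<open>\<epsilon>\<^bsub>\<pi> i\<^esub>\<close>, whose \<open>bar\<close> is a simple root of the folded graph.

  About the graph itself this needs three classical facts: real roots are positive or negative
  (\<open>real_root_sign\<close>), \<open>r\<^sub>i\<close> permutes the positive roots other than \<open>\<epsilon>\<^sub>i\<close> (\<open>gpos_roots_r\<close>), and
  supports of positive roots are connected (\<open>gpos_roots_connected\<close>). All three come from the
  length function on the Weyl group, through \<open>W_pos_of_ascent\<close> and \<open>antidominant_minimal\<close>. For
  the folded graph no such theory enters; its roots are only handled through the identification
  above.\<close>

section \<open>Lattice vectors and words in reflections\<close>

abbreviation coef :: "('a \<Rightarrow>\<^sub>0 int) \<Rightarrow> 'a \<Rightarrow> int" where
  "coef \<equiv> Poly_Mapping.lookup"

lemma mem_root_lattice_iff: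
  "\<alpha> \<in> root_lattice V \<longleftrightarrow> (\<forall>k. k \<notin> V \<longrightarrow> Poly_Mapping.lookup \<alpha> k = 0)"
  by (auto simp: root_lattice_def in_keys_iff)

lemma mem_root_lattice_pos_iff:
  "\<alpha> \<in> root_lattice_pos V \<longleftrightarrow> \<alpha> \<in> root_lattice V \<and> (\<forall>k. 0 \<le> Poly_Mapping.lookup \<alpha> k)"
proof -
  have "0 \<le> Poly_Mapping.lookup \<alpha> k"
    if "\<alpha> \<in> root_lattice V" "\<forall>i\<in>V. 0 \<le> Poly_Mapping.lookup \<alpha> i" for k
    using that by (cases "k \<in> V") (auto simp: mem_root_lattice_iff)
  then show ?thesis
    by (auto simp: root_lattice_pos_def)
qed

lemma lookup_frag_extend:
  assumes "finite A" "Poly_Mapping.keys x \<subseteq> A"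
  shows "Poly_Mapping.lookup (frag_extend b x) k
           = (\<Sum>i\<in>A. Poly_Mapping.lookup x i * Poly_Mapping.lookup (b i) k)"
proof -
  have "Poly_Mapping.lookup (frag_extend b x) k
          = (\<Sum>i\<in>Poly_Mapping.keys x. Poly_Mapping.lookup x i * Poly_Mapping.lookup (b i) k)"
    by (simp add: frag_extend_def lookup_sum)
  also have "\<dots> = (\<Sum>i\<in>A. Poly_Mapping.lookup x i * Poly_Mapping.lookup (b i) k)"
    using assms by (intro sum.mono_neutral_left) (auto simp: in_keys_iff)
  finally show ?thesis .
qed

lemma generated_by_image_iff:
  "w \<in> generated_by (r ` V) \<longleftrightarrow> (\<exists>xs. set xs \<subseteq> V \<and> w = foldr r xs)"
proof
  assume "w \<in> generated_by (r ` V)"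
  then show "\<exists>xs. set xs \<subseteq> V \<and> w = foldr r xs"
  proof induction
    case id
    show ?case by (rule exI[of _ "[]"]) auto
  next
    case (comp s w)
    then obtain i xs where "i \<in> V" "s = r i" "set xs \<subseteq> V" "w = foldr r xs" by auto
    then show ?case by (intro exI[of _ "i # xs"]) auto
  qed
next
  have "foldr r xs \<in> generated_by (r ` V)" if "set xs \<subseteq> V" for xs
    using that by (induction xs) (auto intro: generated_by.intros)
  then show "\<exists>xs. set xs \<subseteq> V \<and> w = foldr r xs \<Longrightarrow> w \<in> generated_by (r ` V)" by auto
qed

section \<open>Connected subsets\<close>

lemma connected_subset_insert:
  assumes "connected_subset adj S" "u \<in> S" "adj u i" "adj i u"
  shows "connected_subset adj (insert i S)"
proof -
  let ?R = "{(x, y). x \<in> insert i S \<and> y \<in> insert i S \<and> adj x y}"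
  have "{(x, y). x \<in> S \<and> y \<in> S \<and> adj x y}\<^sup>* \<subseteq> ?R\<^sup>*"
    by (rule rtrancl_mono) auto
  then have S: "(x, y) \<in> ?R\<^sup>*" if "x \<in> S" "y \<in> S" for x y
    using that assms(1) by (auto simp: connected_subset_def)
  have "(u, i) \<in> ?R\<^sup>*" "(i, u) \<in> ?R\<^sup>*" using assms by (auto intro!: r_into_rtrancl)
  then have "(x, u) \<in> ?R\<^sup>*" "(u, x) \<in> ?R\<^sup>*" if "x \<in> insert i S" for x
    using that S assms(2) by auto
  then show ?thesis
    unfolding connected_subset_def by (meson rtrancl_trans)
qed

lemma rtrancl_map:
  assumes "\<And>x y. (x, y) \<in> R \<Longrightarrow> (f x, f y) \<in> Q" "(x, y) \<in> R\<^sup>*"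
  shows "(f x, f y) \<in> Q\<^sup>*"
  using assms(2) by induction (auto intro: rtrancl_into_rtrancl assms(1))

text \<open>The component of \<open>a\<close> in \<open>S\<close> is connected inside itself, not only through paths in \<open>S\<close>, because
  every path in \<open>S\<close> that starts at \<open>a\<close> stays in it.\<close>

lemma component_connected:
  fixes adj :: "'b \<Rightarrow> 'b \<Rightarrow> bool"
  assumes sym: "\<And>x y. adj x y \<Longrightarrow> adj y x" and a: "a \<in> S"
  defines "C \<equiv> {x. (a, x) \<in> {(x, y). x \<in> S \<and> y \<in> S \<and> adj x y}\<^sup>*}"
  shows "C \<subseteq> S" "a \<in> C" "connected_subset adj C"
    and "\<And>x y. x \<in> C \<Longrightarrow> y \<in> S \<Longrightarrow> adj x y \<Longrightarrow> y \<in> C"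
proof -
  let ?R = "{(x, y). x \<in> S \<and> y \<in> S \<and> adj x y}"
  let ?Q = "{(x, y). x \<in> C \<and> y \<in> C \<and> adj x y}"
  show sub: "C \<subseteq> S"
  proof
    fix x assume "x \<in> C"
    then have "(a, x) \<in> ?R\<^sup>*" by (simp add: C_def)
    then show "x \<in> S" using a by (cases rule: rtranclE) auto
  qed
  show aC: "a \<in> C" by (simp add: C_def)
  show step: "y \<in> C" if "x \<in> C" "y \<in> S" "adj x y" for x y
  proof -
    have "(x, y) \<in> ?R" using that sub by auto
    moreover have "(a, x) \<in> ?R\<^sup>*" using that by (simp add: C_def)
    ultimately have "(a, y) \<in> ?R\<^sup>*" by (rule rtrancl_into_rtrancl[rotated])
    then show ?thesis by (simp add: C_def)
  qed
  have path: "(a, x) \<in> ?Q\<^sup>*" if "x \<in> C" for x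
  proof -
    have "(a, x) \<in> ?R\<^sup>*" using that by (simp add: C_def)
    then have "(a, x) \<in> ?Q\<^sup>* \<and> x \<in> C"
    proof induction
      case base then show ?case using aC by simp
    next
      case (step y z)
      then have "z \<in> C" using \<open>\<And>x y. x \<in> C \<Longrightarrow> y \<in> S \<Longrightarrow> adj x y \<Longrightarrow> y \<in> C\<close> by auto
      then have "(y, z) \<in> ?Q" using step by auto
      then show ?case using step \<open>z \<in> C\<close> by (auto intro: rtrancl_into_rtrancl)
    qed
    then show ?thesis ..
  qed
  have "sym ?Q" using sym by (auto simp: sym_def)
  then have "sym (?Q\<^sup>*)" by (rule sym_rtrancl)
  then have "(x, a) \<in> ?Q\<^sup>*" if "x \<in> C" for x using path[OF that] by (rule symD)
  then show "connected_subset adj C"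
    unfolding connected_subset_def using path by (meson rtrancl_trans)
qed


section \<open>The Weyl group of a simply laced graph\<close>

locale simply_laced =
  fixes V :: "'a set" and E :: "'a set set"
  assumes graph: "simple_graph V E"
begin

abbreviation r :: "'a \<Rightarrow> ('a \<Rightarrow>\<^sub>0 int) \<Rightarrow> ('a \<Rightarrow>\<^sub>0 int)" where
  "r \<equiv> greflection V E"

abbreviation W :: "(('a \<Rightarrow>\<^sub>0 int) \<Rightarrow> ('a \<Rightarrow>\<^sub>0 int)) set" where
  "W \<equiv> gweyl V E"

abbreviation pos :: "('a \<Rightarrow>\<^sub>0 int) set" where
  "pos \<equiv> root_lattice_pos V"

definition nbrs :: "'a \<Rightarrow> 'a set" where
  "nbrs i = {j \<in> V. {i, j} \<in> E}"

text \<open>This is \<open>2\<langle>\<alpha>, \<epsilon>\<^sub>i\<rangle>\<close> (lemma \<open>gform_pairing\<close>), written so that it is visibly an integer;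
  all later arguments use it in place of the rational form.\<close>

definition pairing :: "('a \<Rightarrow>\<^sub>0 int) \<Rightarrow> 'a \<Rightarrow> int" where
  "pairing \<alpha> i = 2 * coef \<alpha> i - (\<Sum>j\<in>nbrs i. coef \<alpha> j)"

lemma finite_V [simp]: "finite V"
  using graph by (simp add: simple_graph_def)

lemma edge_endpoints:
  assumes "{u, v} \<in> E" shows "u \<in> V" "v \<in> V" "u \<noteq> v"
  using graph assms unfolding simple_graph_def by (force simp: doubleton_eq_iff)+

lemma finite_nbrs [simp]: "finite (nbrs i)"
  by (simp add: nbrs_def)

lemma nbrs_iff: "j \<in> nbrs i \<longleftrightarrow> {i, j} \<in> E"
  using edge_endpoints by (auto simp: nbrs_def)

lemma nbrs_sym: "j \<in> nbrs i \<longleftrightarrow> i \<in> nbrs j"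
  by (simp add: nbrs_iff insert_commute)

lemma not_nbrs_self [simp]: "i \<notin> nbrs i"
  using edge_endpoints(3)[of i i] by (auto simp: nbrs_iff)

lemma gform_pairing:
  assumes "i \<in> V" shows "2 * gform V E \<alpha> (frag_of i) = of_int (pairing \<alpha> i)"
proof -
  have "gform V E \<alpha> (frag_of i)
          = (\<Sum>k\<in>V. of_int (coef \<alpha> k) * (if k = i then 1 else if {k, i} \<in> E then - 1 / 2 else 0))"
    unfolding gform_def
  proof (intro sum.cong refl, goal_cases)
    case (1 k)
    have "(\<Sum>j\<in>V. rat_of_int (coef \<alpha> k) * of_int (coef (frag_of i) j) *
             (if k = j then 1 else if {k, j} \<in> E then - 1 / 2 else 0))
          = (\<Sum>j\<in>{i}. rat_of_int (coef \<alpha> k) * of_int (coef (frag_of i) j) *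
             (if k = j then 1 else if {k, j} \<in> E then - 1 / 2 else 0))"
      using assms by (intro sum.mono_neutral_right) auto
    then show ?case by simp
  qed
  also have "\<dots> = (\<Sum>k\<in>V. (if k = i then of_int (coef \<alpha> k) else 0)
                         - (if k \<in> nbrs i then of_int (coef \<alpha> k) / 2 else 0))"
    using edge_endpoints(3) by (intro sum.cong refl) (auto simp: nbrs_iff insert_commute)
  also have "\<dots> = of_int (coef \<alpha> i) - (\<Sum>k\<in>V. if k \<in> nbrs i then of_int (coef \<alpha> k) / 2 else 0)"
    using assms by (simp add: sum_subtractf)
  also have "(\<Sum>k\<in>V. if k \<in> nbrs i then of_int (coef \<alpha> k) / 2 else (0::rat))
              = (\<Sum>k\<in>nbrs i. of_int (coef \<alpha> k) / 2)"
    by (subst sum.inter_restrict[symmetric]) (auto intro!: sum.cong simp: nbrs_def)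
  finally show ?thesis
    by (simp add: pairing_def sum_divide_distrib[symmetric] algebra_simps)
qed

lemma r_eq: "i \<in> V \<Longrightarrow> r i \<alpha> = \<alpha> - frag_cmul (pairing \<alpha> i) (frag_of i)"
  by (simp add: greflection_def gform_pairing)

lemma lookup_r:
  "i \<in> V \<Longrightarrow> coef (r i \<alpha>) k = coef \<alpha> k - (if k = i then pairing \<alpha> i else 0)"
  by (simp add: r_eq lookup_minus)

lemma pairing_linear:
  "pairing (\<alpha> + \<beta>) i = pairing \<alpha> i + pairing \<beta> i"
  "pairing (\<alpha> - \<beta>) i = pairing \<alpha> i - pairing \<beta> i"
  "pairing (- \<alpha>) i = - pairing \<alpha> i"
  "pairing (frag_cmul c \<alpha>) i = c * pairing \<alpha> i"
  by (simp_all add: pairing_def lookup_add lookup_minus sum.distrib sum_subtractf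
      sum_negf sum_distrib_left[symmetric] algebra_simps)

lemma pairing_frag_of:
  "pairing (frag_of j) i = (if i = j then 2 else if j \<in> nbrs i then -1 else 0)"
  by (auto simp: pairing_def)

lemma r_linear:
  assumes "i \<in> V"
  shows "r i (\<alpha> + \<beta>) = r i \<alpha> + r i \<beta>" "r i (\<alpha> - \<beta>) = r i \<alpha> - r i \<beta>"
    "r i (- \<alpha>) = - r i \<alpha>" "r i (frag_cmul c \<alpha>) = frag_cmul c (r i \<alpha>)"
  using assms by (auto intro!: poly_mapping_eqI
      simp: lookup_r pairing_linear lookup_add lookup_minus algebra_simps)

lemma r_r [simp]: "i \<in> V \<Longrightarrow> r i (r i \<alpha>) = \<alpha>"
  by (rule poly_mapping_eqI) (simp add: lookup_r r_eq pairing_linear pairing_frag_of lookup_minus)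

lemma r_frag_of:
  assumes "i \<in> V"
  shows "r i (frag_of j) = (if i = j then - frag_of i
           else if j \<in> nbrs i then frag_of j + frag_of i else frag_of j)"
  using assms by (auto intro!: poly_mapping_eqI simp: lookup_r pairing_frag_of lookup_add)

lemma r_commute:
  assumes "i \<in> V" "j \<in> V" "i \<noteq> j" "j \<notin> nbrs i"
  shows "r i \<circ> r j = r j \<circ> r i"
proof -
  have "i \<notin> nbrs j" using assms nbrs_sym by blast
  then show ?thesis using assms
    by (auto intro!: ext poly_mapping_eqI
        simp: lookup_r r_eq pairing_linear pairing_frag_of lookup_minus)
qed

lemma r_braid:
  assumes "i \<in> V" "j \<in> V" "j \<in> nbrs i"
  shows "r i \<circ> r j \<circ> r i = r j \<circ> r i \<circ> r j"
proof -
  have "i \<in> nbrs j" "i \<noteq> j" using assms nbrs_sym not_nbrs_self by blast+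
  then show ?thesis using assms
    by (auto intro!: ext poly_mapping_eqI
        simp: lookup_r r_eq pairing_linear pairing_frag_of lookup_minus)
qed

lemma r_root_lattice [simp]:
  "i \<in> V \<Longrightarrow> \<alpha> \<in> root_lattice V \<Longrightarrow> r i \<alpha> \<in> root_lattice V"
  by (auto simp: mem_root_lattice_iff lookup_r)

lemma W_iff: "w \<in> W \<longleftrightarrow> (\<exists>xs. set xs \<subseteq> V \<and> w = foldr r xs)"
  by (simp add: gweyl_def generated_by_image_iff)

lemma W_words [intro]: "set xs \<subseteq> V \<Longrightarrow> foldr r xs \<in> W"
  by (auto simp: W_iff)

lemma W_comp:
  assumes "v \<in> W" "w \<in> W" shows "v \<circ> w \<in> W"
proof -
  obtain xs ys where "set xs \<subseteq> V" "v = foldr r xs" "set ys \<subseteq> V" "w = foldr r ys"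
    using assms by (auto simp: W_iff)
  then show ?thesis
    by (auto simp: W_iff intro!: exI[of _ "xs @ ys"])
qed

lemma r_in_W [simp]: "i \<in> V \<Longrightarrow> r i \<in> W"
  using W_words[of "[i]"] by (simp add: id_def comp_def)

lemma id_in_W [simp]: "id \<in> W"
  using W_words[of "[]"] by simp

lemma W_induct [consumes 1, case_names id comp]:
  assumes "w \<in> W" "P id" "\<And>i w. i \<in> V \<Longrightarrow> w \<in> W \<Longrightarrow> P w \<Longrightarrow> P (r i \<circ> w)"
  shows "P w"
  using assms(1) unfolding gweyl_def
proof induction
  case id show ?case by (rule assms(2))
next
  case (comp s w)
  then show ?case using assms(3) by (metis gweyl_def imageE)
qed

lemma W_linear:
  assumes "w \<in> W"
  shows "w (\<alpha> + \<beta>) = w \<alpha> + w \<beta> \<and> w (\<alpha> - \<beta>) = w \<alpha> - w \<beta> \<and>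
    w (- \<alpha>) = - w \<alpha> \<and> w (frag_cmul c \<alpha>) = frag_cmul c (w \<alpha>)"
  using assms by (induction rule: W_induct) (auto simp: r_linear)

lemmas W_add = W_linear[THEN conjunct1]
  and W_diff = W_linear[THEN conjunct2, THEN conjunct1]
  and W_minus = W_linear[THEN conjunct2, THEN conjunct2, THEN conjunct1]
  and W_cmul = W_linear[THEN conjunct2, THEN conjunct2, THEN conjunct2]

lemma W_root_lattice: "w \<in> W \<Longrightarrow> \<alpha> \<in> root_lattice V \<Longrightarrow> w \<alpha> \<in> root_lattice V"
  by (induction rule: W_induct) auto

lemma W_inverse:
  assumes "w \<in> W" obtains v where "v \<in> W" "\<And>\<alpha>. v (w \<alpha>) = \<alpha>" "\<And>\<alpha>. w (v \<alpha>) = \<alpha>"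
proof -
  have "\<exists>v\<in>W. (\<forall>\<alpha>. v (w \<alpha>) = \<alpha>) \<and> (\<forall>\<alpha>. w (v \<alpha>) = \<alpha>)"
    using assms
  proof (induction rule: W_induct)
    case id then show ?case by (intro bexI[of _ id]) auto
  next
    case (comp i w)
    then obtain v where "v \<in> W" "\<forall>\<alpha>. v (w \<alpha>) = \<alpha>" "\<forall>\<alpha>. w (v \<alpha>) = \<alpha>" by auto
    with comp show ?case by (intro bexI[of _ "v \<circ> r i"]) (auto intro: W_comp)
  qed
  then show ?thesis using that by blast
qed

lemma frag_of_pos: "i \<in> V \<Longrightarrow> frag_of i \<in> pos"
  by (auto simp: mem_root_lattice_pos_iff mem_root_lattice_iff)

lemma pos_add: "\<alpha> \<in> pos \<Longrightarrow> \<beta> \<in> pos \<Longrightarrow> \<alpha> + \<beta> \<in> pos"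
  by (auto simp: mem_root_lattice_pos_iff mem_root_lattice_iff lookup_add)

lemma pos_cmul: "\<alpha> \<in> pos \<Longrightarrow> 0 \<le> c \<Longrightarrow> frag_cmul c \<alpha> \<in> pos"
  by (auto simp: mem_root_lattice_pos_iff mem_root_lattice_iff)


section \<open>Length and the sign of real roots\<close>

text \<open>Elements of the Weyl group are kept as maps on the lattice, so the length of a map is the minimum
  over all words that represent it. Outside the Weyl group the value has no meaning.\<close>

definition len :: "(('a \<Rightarrow>\<^sub>0 int) \<Rightarrow> ('a \<Rightarrow>\<^sub>0 int)) \<Rightarrow> nat" where
  "len w = (LEAST n. \<exists>xs. set xs \<subseteq> V \<and> length xs = n \<and> w = foldr r xs)"

lemma len_le: "set xs \<subseteq> V \<Longrightarrow> len (foldr r xs) \<le> length xs"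
  unfolding len_def by (rule Least_le) auto

lemma reduced_word:
  assumes "w \<in> W" obtains xs where "set xs \<subseteq> V" "w = foldr r xs" "length xs = len w"
proof -
  have "\<exists>n xs. set xs \<subseteq> V \<and> length xs = n \<and> w = foldr r xs"
    using assms by (auto simp: W_iff)
  from LeastI_ex[OF this] show ?thesis
    unfolding len_def[symmetric] using that by auto
qed

lemma len_r_le:
  assumes "w \<in> W" "i \<in> V" shows "len (w \<circ> r i) \<le> Suc (len w)"
proof -
  obtain xs where xs: "set xs \<subseteq> V" "w = foldr r xs" "length xs = len w"
    using reduced_word[OF assms(1)] .
  then have "w \<circ> r i = foldr r (xs @ [i])" by auto
  then show ?thesis using len_le[of "xs @ [i]"] xs assms by auto
qed

lemma r_r_comp [simp]: "i \<in> V \<Longrightarrow> w \<circ> r i \<circ> r i = w"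
  by (auto simp: fun_eq_iff)

text \<open>The last letter of a reduced word is a right descent.\<close>

lemma len_descent:
  assumes "w \<in> W" "0 < len w"
  obtains j where "j \<in> V" "len (w \<circ> r j) < len w"
proof -
  obtain xs where xs: "set xs \<subseteq> V" "w = foldr r xs" "length xs = len w"
    using reduced_word[OF assms(1)] .
  with assms obtain ys j where ys: "xs = ys @ [j]" by (cases xs rule: rev_cases) auto
  have "w \<circ> r j = foldr r ys" using xs ys by (auto simp: fun_eq_iff)
  then have "len (w \<circ> r j) \<le> length ys" using len_le[of ys] xs ys by auto
  then show ?thesis using that[of j] xs ys by auto
qed

text \<open>The ascent criterion for Coxeter groups. In the simply laced case the reduction to rank two
  subgroups is explicit. Strip the last letter \<open>j\<close> of a reduced word of \<open>w\<close>, so \<open>w = w1 r\<^sub>j\<close>. If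
  \<open>i, j\<close> are not adjacent, then \<open>w \<epsilon>\<^sub>i = w1 \<epsilon>\<^sub>i\<close>. If they are adjacent, then
  \<open>w \<epsilon>\<^sub>i = w1 \<epsilon>\<^sub>i + w1 \<epsilon>\<^sub>j\<close>; this settles the case where \<open>i\<close> is an ascent of \<open>w1\<close>, and when
  \<open>w1 = w2 r\<^sub>i\<close> with \<open>w2\<close> shorter, the sum is \<open>w2 \<epsilon>\<^sub>j\<close>. The ascent of \<open>w1\<close> at \<open>j\<close> holds by
  construction, and the other ones because, by the commutation or braid relation, a descent would give \<open>w r\<^sub>i\<close> a word
  shorter than \<open>w\<close>. The ascent hypothesis is a weak inequality, so the parity of the length never
  has to be discussed.\<close>

lemma W_pos_of_ascent:
  assumes "w \<in> W" "i \<in> V" "len w \<le> len (w \<circ> r i)"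
  shows "w (frag_of i) \<in> pos"
  using assms
proof (induction "len w" arbitrary: w i rule: less_induct)
  case less
  note w = \<open>w \<in> W\<close> \<open>i \<in> V\<close>
  show ?case
  proof (cases "len w = 0")
    case True
    obtain xs where "w = foldr r xs" "length xs = len w" using reduced_word[OF w(1)] by metis
    with True have "w = id" by auto
    then show ?thesis using w frag_of_pos by auto
  next
    case False
    then obtain j where j: "j \<in> V" "len (w \<circ> r j) < len w" using len_descent w by blast
    define w1 where "w1 = w \<circ> r j"
    have w1: "w1 \<in> W" "len w1 < len w" using w j by (auto simp: w1_def intro!: W_comp)
    have w_eq: "w = w1 \<circ> r j" using j by (simp add: w1_def)
    have ij: "i \<noteq> j" using j less.prems by auto
    show ?thesis
    proof (cases "j \<in> nbrs i")
      case False
      have "len w1 \<le> len (w1 \<circ> r i)"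
      proof (rule ccontr)
        assume *: "\<not> ?thesis"
        have "w \<circ> r i = w1 \<circ> (r j \<circ> r i)" by (simp add: w_eq comp_assoc)
        also have "\<dots> = w1 \<circ> r i \<circ> r j" using r_commute[OF w(2) j(1) ij False] by (simp add: comp_assoc)
        finally have "len (w \<circ> r i) \<le> Suc (len (w1 \<circ> r i))"
          using len_r_le[OF W_comp[OF w1(1) r_in_W[OF w(2)]] j(1)] by simp
        then show False using * w1 less.prems by auto
      qed
      then have "w1 (frag_of i) \<in> pos" using less.hyps[OF w1(2,1) w(2)] by simp
      moreover have "w (frag_of i) = w1 (frag_of i)"
        using j ij False nbrs_sym[of i j] by (simp add: w_eq r_frag_of)
      ultimately show ?thesis by simp
    next
      case True
      then have ji: "i \<in> nbrs j" using nbrs_sym by blast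
      show ?thesis
      proof (cases "len w1 \<le> len (w1 \<circ> r i)")
        case True
        have "w1 (frag_of i) \<in> pos" using less.hyps[OF w1(2,1) w(2) True] .
        moreover have "w1 (frag_of j) \<in> pos"
          using less.hyps[OF w1(2,1) j(1)] w1 w_eq by simp
        moreover have "w (frag_of i) = w1 (frag_of i) + w1 (frag_of j)"
          using ji ij j w1 by (auto simp: w_eq r_frag_of W_add)
        ultimately show ?thesis by (simp add: pos_add)
      next
        case False
        define w2 where "w2 = w1 \<circ> r i"
        have w2: "w2 \<in> W" "len w2 < len w1" using False w1 w by (auto simp: w2_def intro!: W_comp)
        have w1_eq: "w1 = w2 \<circ> r i" using w by (simp add: w2_def)
        have "len w2 \<le> len (w2 \<circ> r j)"
        proof (rule ccontr)
          assume *: "\<not> ?thesis"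
          have "w \<circ> r i = w2 \<circ> (r i \<circ> r j \<circ> r i)" by (simp add: w_eq w1_eq comp_assoc)
          also have "\<dots> = w2 \<circ> r j \<circ> r i \<circ> r j"
            using r_braid[OF w(2) j(1) True] by (simp add: comp_assoc)
          finally have "len (w \<circ> r i) \<le> Suc (Suc (len (w2 \<circ> r j)))"
            using len_r_le[OF W_comp[OF W_comp[OF w2(1) r_in_W[OF j(1)]] r_in_W[OF w(2)]] j(1)]
              len_r_le[OF W_comp[OF w2(1) r_in_W[OF j(1)]] w(2)] by simp
          then show False using * w1 w2 less.prems by auto
        qed
        then have "w2 (frag_of j) \<in> pos" using less.hyps[of w2 j] w1 w2 j by simp
        moreover have "w (frag_of i) = w2 (frag_of j)"
          using True ji ij j w w1 w2 by (auto simp: w_eq w1_eq r_frag_of r_linear)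
        ultimately show ?thesis by simp
      qed
    qed
  qed
qed

text \<open>Of the elements \<open>w\<close> and \<open>w r\<^sub>i\<close> at least one has an ascent at \<open>i\<close>, and they map \<open>\<epsilon>\<^sub>i\<close> to
  opposite vectors.\<close>

theorem real_root_sign:
  assumes "w \<in> W" "i \<in> V" shows "w (frag_of i) \<in> pos \<or> - w (frag_of i) \<in> pos"
proof (cases "len w \<le> len (w \<circ> r i)")
  case True then show ?thesis using W_pos_of_ascent assms by blast
next
  case False
  then have "(w \<circ> r i) (frag_of i) \<in> pos"
    by (intro W_pos_of_ascent W_comp r_in_W assms) (simp only: r_r_comp[OF assms(2)])
  then show ?thesis using assms by (simp add: r_frag_of W_minus)
qed

text \<open>With \<open>w = v r\<^sub>j\<close> reduced, \<open>w \<alpha>\<close> differs from \<open>v \<alpha>\<close> by a nonnegative multiple of \<open>v \<epsilon>\<^sub>j\<close>, which is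
  positive since \<open>j\<close> is an ascent of \<open>v\<close>. The consequences used below are that translates of
  fundamental vectors are positive, and that an orbit contains at most one antidominant vector.\<close>

lemma antidominant_minimal:
  assumes "w \<in> W" "\<forall>i\<in>V. pairing \<alpha> i \<le> 0"
  shows "w \<alpha> - \<alpha> \<in> pos"
  using assms(1)
proof (induction "len w" arbitrary: w rule: less_induct)
  case less
  show ?case
  proof (cases "len w = 0")
    case True
    obtain xs where "w = foldr r xs" "length xs = len w" using reduced_word[OF less.prems] by metis
    with True have "w = id" by auto
    then show ?thesis by (auto simp: mem_root_lattice_pos_iff mem_root_lattice_iff)
  next
    case False
    then obtain j where j: "j \<in> V" "len (w \<circ> r j) < len w" using len_descent less.prems by blast
    define v where "v = w \<circ> r j"
    have v: "v \<in> W" "len v < len w" using less.prems j by (auto simp: v_def intro!: W_comp)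
    have w_eq: "w = v \<circ> r j" using j by (simp add: v_def)
    have "v (frag_of j) \<in> pos" using v w_eq j by (intro W_pos_of_ascent) auto
    then have "(v \<alpha> - \<alpha>) + frag_cmul (- pairing \<alpha> j) (v (frag_of j)) \<in> pos"
      using less.hyps[OF v(2,1)] assms(2) j by (intro pos_add pos_cmul) auto
    also have "(v \<alpha> - \<alpha>) + frag_cmul (- pairing \<alpha> j) (v (frag_of j)) = w \<alpha> - \<alpha>"
      using v j by (auto simp: w_eq r_eq W_diff W_cmul intro!: poly_mapping_eqI simp: lookup_add lookup_minus)
    finally show ?thesis .
  qed
qed


section \<open>Positive roots of a simply laced graph\<close>

lemma gfundamental_iff:
  "\<alpha> \<in> gfundamental V E \<longleftrightarrow> \<alpha> \<in> pos \<and> \<alpha> \<noteq> 0 \<and>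
     connected_subset (\<lambda>u v. {u, v} \<in> E) (Poly_Mapping.keys \<alpha>) \<and> (\<forall>i\<in>V. pairing \<alpha> i \<le> 0)"
proof -
  have "gform V E \<alpha> (frag_of i) \<le> 0 \<longleftrightarrow> pairing \<alpha> i \<le> 0" if "i \<in> V" for i
  proof -
    have "gform V E \<alpha> (frag_of i) \<le> 0 \<longleftrightarrow> 2 * gform V E \<alpha> (frag_of i) \<le> 0" by simp
    then show ?thesis unfolding gform_pairing[OF that] by simp
  qed
  then show ?thesis unfolding gfundamental_def by auto
qed

text \<open>Real and imaginary roots are treated together as Weyl group translates of these vectors.\<close>

definition seeds :: "('a \<Rightarrow>\<^sub>0 int) set" where
  "seeds = frag_of ` V \<union> gfundamental V E"

lemma gpos_roots_eq: "gpos_roots V E = {w \<beta> | w \<beta>. w \<in> W \<and> \<beta> \<in> seeds} \<inter> pos"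
proof -
  have "w \<alpha> \<in> pos" if "w \<in> W" "\<alpha> \<in> gfundamental V E" for w \<alpha>
  proof -
    have "(w \<alpha> - \<alpha>) + \<alpha> \<in> pos"
      using that by (intro pos_add antidominant_minimal) (auto simp: gfundamental_iff)
    then show ?thesis by simp
  qed
  then show ?thesis unfolding gpos_roots_def seeds_def by blast
qed

lemma gpos_roots_pos: "\<alpha> \<in> gpos_roots V E \<Longrightarrow> \<alpha> \<in> pos"
  by (simp add: gpos_roots_eq)

lemma W_fundamental: "w \<in> W \<Longrightarrow> \<beta> \<in> gfundamental V E \<Longrightarrow> w \<beta> \<in> gpos_roots V E"
  unfolding gpos_roots_def by blast

lemma W_simple: "w \<in> W \<Longrightarrow> i \<in> V \<Longrightarrow> w (frag_of i) \<in> pos \<Longrightarrow> w (frag_of i) \<in> gpos_roots V E"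
  unfolding gpos_roots_def by blast

text \<open>Imaginary roots stay positive under the whole Weyl group. A real root other than \<open>\<epsilon>\<^sub>i\<close> that has
  a positive coordinate away from \<open>i\<close> keeps it under \<open>r\<^sub>i\<close>, so the sign of its image is positive.
  The only other possibility is a multiple \<open>c \<epsilon>\<^sub>i\<close>.\<close>

lemma gpos_roots_r:
  assumes "\<alpha> \<in> gpos_roots V E" "i \<in> V" "\<alpha> \<noteq> frag_of i"
  shows "r i \<alpha> \<in> gpos_roots V E"
proof -
  have *: "r i \<alpha> \<in> pos"
  proof -
    from assms(1) consider (imag) w \<beta> where "w \<in> W" "\<beta> \<in> gfundamental V E" "\<alpha> = w \<beta>"
      | (real) w j where "w \<in> W" "j \<in> V" "\<alpha> = w (frag_of j)" "\<alpha> \<in> pos"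
      unfolding gpos_roots_def by blast
    then show ?thesis
    proof cases
      case imag
      have "(r i \<circ> w) \<beta> \<in> gpos_roots V E" using imag assms by (intro W_fundamental W_comp) auto
      then show ?thesis using imag gpos_roots_pos by auto
    next
      case real
      have sgn: "r i \<alpha> \<in> pos \<or> - r i \<alpha> \<in> pos"
        using real_root_sign[OF W_comp[OF r_in_W[OF assms(2)] real(1)] real(2)] real(3) by simp
      show ?thesis
      proof (cases "\<exists>k. k \<noteq> i \<and> coef \<alpha> k \<noteq> 0")
        case True
        then obtain k where k: "k \<noteq> i" "coef \<alpha> k \<noteq> 0" by blast
        then have "0 < coef \<alpha> k" using real by (auto simp: mem_root_lattice_pos_iff less_le)
        then have "0 < coef (r i \<alpha>) k" using k assms by (simp add: lookup_r)
        then have "- r i \<alpha> \<notin> pos" by (auto simp: mem_root_lattice_pos_iff not_le intro!: exI[of _ k])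
        then show ?thesis using sgn by blast
      next
        case False
        define c where "c = coef \<alpha> i"
        have \<alpha>: "\<alpha> = frag_cmul c (frag_of i)" using False by (auto intro!: poly_mapping_eqI simp: c_def)
        \<comment> \<open>Applying the inverse of \<open>w\<close> shows that \<open>c\<close> divides the simple root \<open>\<epsilon>\<^sub>j\<close>, hence \<open>c = 1\<close>.\<close>
        obtain v where v: "v \<in> W" "\<And>\<alpha>. v (w \<alpha>) = \<alpha>" using W_inverse[OF real(1)] by metis
        have "frag_of j = frag_cmul c (v (frag_of i))"
          using v real(3) \<alpha> W_cmul by metis
        then have "1 = c * coef (v (frag_of i)) j"
          by (metis lookup_frag_cmul lookup_single_eq)
        then have "c dvd 1" by (metis dvd_triv_left)
        moreover have "0 \<le> c" using real by (auto simp: c_def mem_root_lattice_pos_iff)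
        ultimately have "c = 1" by simp
        then show ?thesis using \<alpha> assms by simp
      qed
    qed
  qed
  obtain w \<beta> where "w \<in> W" "\<beta> \<in> seeds" "\<alpha> = w \<beta>" using assms by (auto simp: gpos_roots_eq)
  then have "r i \<circ> w \<in> W" "r i \<alpha> = (r i \<circ> w) \<beta>" using assms by (auto intro: W_comp)
  then show ?thesis using * \<open>\<beta> \<in> seeds\<close> unfolding gpos_roots_eq by blast
qed

lemma gpos_roots_nonzero:
  assumes "\<alpha> \<in> gpos_roots V E" shows "\<alpha> \<noteq> 0"
proof
  assume "\<alpha> = 0"
  obtain w \<beta> where w: "w \<in> W" "\<beta> \<in> seeds" "\<alpha> = w \<beta>"
    using assms by (auto simp: gpos_roots_eq)
  obtain v where v: "v \<in> W" "\<And>\<alpha>. v (w \<alpha>) = \<alpha>" using W_inverse[OF w(1)] by metis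
  have "\<beta> = v 0" using v(2)[of \<beta>] w \<open>\<alpha> = 0\<close> by simp
  also have "v 0 = 0" using W_diff[OF v(1), of 0 0] by simp
  finally show False using w(2) by (auto simp: seeds_def gfundamental_iff)
qed

text \<open>An antidominant vector is minimal in its orbit. For a root in the orbit of \<open>\<epsilon>\<^sub>i\<close> this forces
  \<open>\<alpha> = \<epsilon>\<^sub>i\<close>, which is not antidominant; for a root in the orbit of a fundamental vector \<open>\<beta>\<close>,
  both are minimal and so \<open>\<alpha> = \<beta>\<close>.\<close>

lemma antidominant_root_fundamental:
  assumes "\<alpha> \<in> gpos_roots V E" "\<forall>i\<in>V. pairing \<alpha> i \<le> 0"
  shows "\<alpha> \<in> gfundamental V E"
proof -
  obtain w \<beta> where w: "w \<in> W" "\<beta> \<in> seeds" "\<alpha> = w \<beta>" "\<alpha> \<in> pos"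
    using assms by (auto simp: gpos_roots_eq)
  obtain v where v: "v \<in> W" "\<And>\<alpha>. v (w \<alpha>) = \<alpha>" "\<And>\<alpha>. w (v \<alpha>) = \<alpha>" using W_inverse[OF w(1)] by metis
  have "v \<alpha> - \<alpha> \<in> pos" using antidominant_minimal[OF v(1) assms(2)] .
  then have le: "\<beta> - \<alpha> \<in> pos" using v w by simp
  from w(2) consider i where "i \<in> V" "\<beta> = frag_of i" | "\<beta> \<in> gfundamental V E"
    by (auto simp: seeds_def)
  then show ?thesis
  proof cases
    case 1
    have "\<alpha> \<noteq> 0" using gpos_roots_nonzero[OF assms(1)] .
    have bd: "0 \<le> coef \<alpha> k" "coef \<alpha> k \<le> (if k = i then 1 else 0)" for k
      using le w(4) 1(2) by (force simp: mem_root_lattice_pos_iff lookup_minus)+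
    have zero: "coef \<alpha> k = 0" if "k \<noteq> i" for k using bd[of k] that by simp
    have "coef \<alpha> i \<noteq> 0"
    proof
      assume "coef \<alpha> i = 0"
      then have "\<alpha> = 0" using zero by (intro poly_mapping_eqI) (metis lookup_zero)
      with \<open>\<alpha> \<noteq> 0\<close> show False ..
    qed
    then have "coef \<alpha> i = 1" using bd[of i] by auto
    then have "\<alpha> = frag_of i" using zero by (auto intro!: poly_mapping_eqI)
    then show ?thesis using assms 1 by (auto simp: pairing_frag_of)
  next
    case 2
    then have "w \<beta> - \<beta> \<in> pos" using w by (intro antidominant_minimal) (auto simp: gfundamental_iff)
    then have "\<alpha> = \<beta>" using le w by (auto intro!: poly_mapping_eqI antisym simp: mem_root_lattice_pos_iff lookup_minus)
    then show ?thesis using 2 by simp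
  qed
qed

definition height :: "('a \<Rightarrow>\<^sub>0 int) \<Rightarrow> nat" where
  "height \<alpha> = nat (\<Sum>k\<in>V. coef \<alpha> k)"

lemma height_less:
  assumes "\<alpha> \<in> pos" "(\<Sum>k\<in>V. coef \<beta> k) < (\<Sum>k\<in>V. coef \<alpha> k)" "\<beta> \<in> pos"
  shows "height \<beta> < height \<alpha>"
proof -
  have "0 \<le> (\<Sum>k\<in>V. coef \<beta> k)" using assms by (intro sum_nonneg) (auto simp: mem_root_lattice_pos_iff)
  then show ?thesis using assms by (simp add: height_def)
qed

text \<open>Lower the height by reflections until the root is simple or antidominant. When a reflection
  \<open>r\<^sub>i\<close> adds a new vertex \<open>i\<close> to the support, the coefficient \<open>\<alpha>\<^sub>i\<close> equals \<open>pairing \<alpha> i\<close>, so the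
  coefficients of \<open>\<alpha>\<close> at the neighbours of \<open>i\<close> add up to \<open>\<alpha>\<^sub>i > 0\<close> and \<open>i\<close> is attached to the old
  support.\<close>

theorem gpos_roots_connected:
  assumes "\<alpha> \<in> gpos_roots V E"
  shows "connected_subset (\<lambda>u v. {u, v} \<in> E) (Poly_Mapping.keys \<alpha>)"
  using assms
proof (induction "height \<alpha>" arbitrary: \<alpha> rule: less_induct)
  case less
  show ?case
  proof (cases "\<forall>i\<in>V. pairing \<alpha> i \<le> 0")
    case True
    then show ?thesis using antidominant_root_fundamental[OF less.prems] by (simp add: gfundamental_iff)
  next
    case False
    then obtain i where i: "i \<in> V" "0 < pairing \<alpha> i" by force
    show ?thesis
    proof (cases "\<alpha> = frag_of i")
      case True
      then show ?thesis by (auto simp: connected_subset_def)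
    next
      case False
      define \<beta> where "\<beta> = r i \<alpha>"
      have \<beta>: "\<beta> \<in> gpos_roots V E" using gpos_roots_r less.prems i False by (simp add: \<beta>_def)
      have \<beta>_coef: "coef \<beta> k = coef \<alpha> k - (if k = i then pairing \<alpha> i else 0)" for k
        using i by (simp add: \<beta>_def lookup_r)
      have "(\<Sum>k\<in>V. coef \<beta> k) = (\<Sum>k\<in>V. coef \<alpha> k) - pairing \<alpha> i"
        using i by (simp add: \<beta>_coef sum_subtractf)
      then have "height \<beta> < height \<alpha>" using gpos_roots_pos less.prems \<beta> i by (intro height_less) auto
      then have conn: "connected_subset (\<lambda>u v. {u, v} \<in> E) (Poly_Mapping.keys \<beta>)"
        using less.hyps \<beta> by blast
      have nn: "0 \<le> coef \<beta> k" for k using gpos_roots_pos[OF \<beta>] by (simp add: mem_root_lattice_pos_iff)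
      then have "0 < coef \<alpha> i" using nn[of i] i by (simp add: \<beta>_coef)
      then have keys: "Poly_Mapping.keys \<alpha> = insert i (Poly_Mapping.keys \<beta>)"
        by (auto simp: in_keys_iff \<beta>_coef split: if_splits)
      show ?thesis
      proof (cases "i \<in> Poly_Mapping.keys \<beta>")
        case True then show ?thesis using conn keys by (simp add: insert_absorb)
      next
        case False
        then have "coef \<alpha> i = pairing \<alpha> i" by (simp add: in_keys_iff \<beta>_coef)
        then have "(\<Sum>j\<in>nbrs i. coef \<alpha> j) \<noteq> 0" using i by (simp add: pairing_def)
        then obtain j where j: "j \<in> nbrs i" "coef \<alpha> j \<noteq> 0" using sum.not_neutral_contains_not_neutral by metis
        then have "j \<noteq> i" by auto
        then have "j \<in> Poly_Mapping.keys \<beta>" using j by (simp add: in_keys_iff \<beta>_coef)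
        moreover have "{i, j} \<in> E" "{j, i} \<in> E" using j by (auto simp: nbrs_iff insert_commute)
        ultimately show ?thesis unfolding keys using conn by (intro connected_subset_insert)
      qed
    qed
  qed
qed

end


section \<open>Graphs with an admissible involution\<close>

locale folding = simply_laced V E for V :: "'a set" and E +
  fixes \<pi> :: "'a \<Rightarrow> 'a" and \<sigma> :: "'a \<Rightarrow> int"
  assumes automorphism: "graph_automorphism V E \<pi>"
    and involution: "involutive_on V \<pi>"
    and admissible: "admissible E \<pi>"
    and signs: "\<forall>j\<in>fixed_vertices V \<pi>. \<sigma> j \<in> {1, -1}"
begin

abbreviation orb :: "'a \<Rightarrow> 'a set" where "orb \<equiv> vorbit \<pi>"
abbreviation Orb :: "'a set set" where "Orb \<equiv> orb ` V"
abbreviation A :: "'a set \<Rightarrow> 'a set \<Rightarrow> int" where "A \<equiv> folded_cartan V E \<pi> \<sigma>"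
abbreviation \<phi> :: "('a set \<Rightarrow>\<^sub>0 int) \<Rightarrow> ('a \<Rightarrow>\<^sub>0 int)" where "\<phi> \<equiv> frag_extend (orbit_beta V \<pi> \<sigma>)"
abbreviation Sym :: "('a \<Rightarrow>\<^sub>0 int) set" where "Sym \<equiv> sym_lattice V \<pi> \<sigma>"
abbreviation bar :: "('a \<Rightarrow>\<^sub>0 int) \<Rightarrow> ('a \<Rightarrow>\<^sub>0 int)" where "bar \<equiv> symmetrize V \<pi> \<sigma>"

text \<open>The coefficient of \<open>\<beta>\<close> at a vertex of its orbit.\<close>

definition mult :: "'a \<Rightarrow> int" where
  "mult i = (if \<pi> i = i \<and> \<sigma> i = -1 then 2 else 1)"

lemma pi_pi [simp]: "i \<in> V \<Longrightarrow> \<pi> (\<pi> i) = i"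
  using involution by (simp add: involutive_on_def)

lemma pi_V [simp]: "i \<in> V \<Longrightarrow> \<pi> i \<in> V"
  using automorphism by (auto simp: graph_automorphism_def bij_betw_def)

lemma pi_eq_swap: "i \<in> V \<Longrightarrow> j \<in> V \<Longrightarrow> \<pi> i = j \<longleftrightarrow> i = \<pi> j"
  by (metis pi_pi)

lemma pi_edge: "i \<in> V \<Longrightarrow> j \<in> V \<Longrightarrow> {\<pi> i, \<pi> j} \<in> E \<longleftrightarrow> {i, j} \<in> E"
  using automorphism unfolding graph_automorphism_def by blast

lemma nbrs_V: "j \<in> nbrs i \<Longrightarrow> j \<in> V"
  by (simp add: nbrs_def)

lemma pi_nbrs_iff: "i \<in> V \<Longrightarrow> j \<in> V \<Longrightarrow> \<pi> j \<in> nbrs i \<longleftrightarrow> j \<in> nbrs (\<pi> i)"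
  using pi_edge[of "\<pi> i" j] by (auto simp: nbrs_iff)

lemma nbrs_pi: "i \<in> V \<Longrightarrow> nbrs (\<pi> i) = \<pi> ` nbrs i"
proof (intro equalityI subsetI)
  fix j assume i: "i \<in> V" and j: "j \<in> nbrs (\<pi> i)"
  then have "\<pi> j \<in> nbrs i" using nbrs_V[OF j] by (simp add: pi_nbrs_iff)
  then show "j \<in> \<pi> ` nbrs i" using nbrs_V[OF j] by (metis image_eqI pi_pi)
next
  fix j assume i: "i \<in> V" and "j \<in> \<pi> ` nbrs i"
  then obtain k where k: "j = \<pi> k" "k \<in> nbrs i" by auto
  then show "j \<in> nbrs (\<pi> i)" using i nbrs_V[OF k(2)] by (simp add: pi_nbrs_iff)
qed

lemma edge_not_stable: "{i, j} \<in> E \<Longrightarrow> {\<pi> i, \<pi> j} \<noteq> {i, j}"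
  using admissible unfolding admissible_def by (metis image_empty image_insert)

lemma pi_not_nbr: "i \<in> V \<Longrightarrow> \<pi> i \<notin> nbrs i"
  using edge_not_stable[of i "\<pi> i"] by (auto simp: nbrs_iff)

lemma fixed_not_nbr: "\<pi> i = i \<Longrightarrow> \<pi> j = j \<Longrightarrow> j \<notin> nbrs i"
  using edge_not_stable[of i j] by (auto simp: nbrs_iff)

lemma fixed_iff: "i \<in> fixed_vertices V \<pi> \<longleftrightarrow> i \<in> V \<and> \<pi> i = i"
  by (simp add: fixed_vertices_def)

lemma sign_cases: "i \<in> V \<Longrightarrow> \<pi> i = i \<Longrightarrow> \<sigma> i = 1 \<or> \<sigma> i = -1"
  using signs by (auto simp: fixed_iff)

lemma orb_eq_iff: "i \<in> V \<Longrightarrow> j \<in> V \<Longrightarrow> orb i = orb j \<longleftrightarrow> i = j \<or> i = \<pi> j"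
  unfolding vorbit_def doubleton_eq_iff by (metis pi_pi)

lemma mem_orb: "i \<in> V \<Longrightarrow> k \<in> orb i \<longleftrightarrow> k \<in> V \<and> orb k = orb i"
  using orb_eq_iff[of k i] by (auto simp: vorbit_def)

lemma orb_pi [simp]: "i \<in> V \<Longrightarrow> orb (\<pi> i) = orb i"
  by (auto simp: vorbit_def)

lemma mult_pi [simp]: "i \<in> V \<Longrightarrow> mult (\<pi> i) = mult i"
  by (auto simp: mult_def)

lemma mult_pos [simp]: "0 < mult i"
  by (simp add: mult_def)

lemma mult_nonzero [simp]: "mult i \<noteq> 0"
  by (simp add: mult_def)


section \<open>The symmetric sublattice\<close>

lemma lookup_act:
  assumes "\<alpha> \<in> root_lattice V"
  shows "coef (act \<pi> \<alpha>) k = (if k \<in> V then coef \<alpha> (\<pi> k) else 0)"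
proof -
  have "coef (act \<pi> \<alpha>) k = (\<Sum>i\<in>V. coef \<alpha> i * (if k = \<pi> i then 1 else 0))"
    unfolding act_def using assms
    by (subst lookup_frag_extend[of V]) (auto simp: root_lattice_def)
  also have "\<dots> = (\<Sum>i\<in>V. if i = \<pi> k \<and> k \<in> V then coef \<alpha> i else 0)"
    by (intro sum.cong refl) auto
  also have "\<dots> = (if k \<in> V then coef \<alpha> (\<pi> k) else 0)"
    by simp
  finally show ?thesis .
qed

lemma act_root_lattice: "\<alpha> \<in> root_lattice V \<Longrightarrow> act \<pi> \<alpha> \<in> root_lattice V"
  by (simp add: lookup_act mem_root_lattice_iff[of "act \<pi> \<alpha>"])

text \<open>At a fixed vertex of sign \<open>-1\<close> the condition \<open>\<sigma>(j)\<^sup>n = 1\<close> says that \<open>n\<close> is even; at all other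
  vertices \<open>mult\<close> is 1. Hence both kinds of conditions are divisibility by \<open>mult\<close>.\<close>

lemma mem_Sym_iff:
  "\<alpha> \<in> Sym \<longleftrightarrow> \<alpha> \<in> root_lattice V \<and> (\<forall>i\<in>V. coef \<alpha> (\<pi> i) = coef \<alpha> i \<and> mult i dvd coef \<alpha> i)"
proof -
  have "rat_of_int (\<sigma> j) powi n = 1 \<longleftrightarrow> mult j dvd n" if "j \<in> V" "\<pi> j = j" for j n
    using sign_cases[OF that] that
    by (auto simp: mult_def power_int_minus_left)
  moreover have "mult j dvd n" if "\<pi> j \<noteq> j" for j n using that by (simp add: mult_def)
  ultimately show ?thesis unfolding sym_lattice_def by (auto simp: fixed_iff)
qed

lemma lookup_orbit_beta:
  assumes "i \<in> V"
  shows "coef (orbit_beta V \<pi> \<sigma> (orb i)) k = (if k \<in> V \<and> orb i = orb k then mult k else 0)"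
proof -
  have "orbit_beta V \<pi> \<sigma> (orb i) = vertex_beta V \<pi> \<sigma> i"
    using assms involution by (intro orbit_beta_vorbit) auto
  moreover have "\<sigma> i = 1 \<or> \<sigma> i = -1" if "\<pi> i = i" using sign_cases assms that by blast
  ultimately show ?thesis
    using assms orb_eq_iff[of i k]
    by (auto simp: vertex_beta_def fixed_iff lookup_add mult_def pi_eq_swap)
qed

text \<open>All computations with \<open>\<phi>\<close> on vectors go through this formula, in which the representatives chosen
  in the definition of \<open>orbit_beta\<close> no longer appear.\<close>

lemma lookup_phi:
  assumes "y \<in> root_lattice Orb"
  shows "coef (\<phi> y) k = (if k \<in> V then mult k * coef y (orb k) else 0)"
proof -
  have "coef (\<phi> y) k = (\<Sum>J\<in>Orb. coef y J * coef (orbit_beta V \<pi> \<sigma> J) k)"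
    using assms by (intro lookup_frag_extend) (auto simp: root_lattice_def)
  also have "\<dots> = (\<Sum>J\<in>Orb. if J = orb k then (if k \<in> V then mult k * coef y (orb k) else 0) else 0)"
  proof (rule sum.cong[OF refl])
    fix J assume "J \<in> Orb"
    then obtain i where "i \<in> V" "J = orb i" by blast
    then show "coef y J * coef (orbit_beta V \<pi> \<sigma> J) k
                 = (if J = orb k then (if k \<in> V then mult k * coef y (orb k) else 0) else 0)"
      by (simp add: lookup_orbit_beta)
  qed
  also have "\<dots> = (if k \<in> V then mult k * coef y (orb k) else 0)"
    by simp
  finally show ?thesis .
qed

lemma phi_root_lattice: "y \<in> root_lattice Orb \<Longrightarrow> \<phi> y \<in> root_lattice V"
  by (simp add: lookup_phi mem_root_lattice_iff[of "\<phi> y"])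

lemma phi_Sym: "y \<in> root_lattice Orb \<Longrightarrow> \<phi> y \<in> Sym"
  by (simp add: mem_Sym_iff phi_root_lattice lookup_phi)

text \<open>The coordinate of the preimage at an orbit is the common coefficient on the orbit divided by
  \<open>mult\<close>.\<close>

lemma Sym_phi:
  assumes "\<alpha> \<in> Sym" obtains y where "y \<in> root_lattice Orb" "\<phi> y = \<alpha>"
proof
  define rep :: "'a set \<Rightarrow> 'a" where "rep J = (SOME i. i \<in> J)" for J
  define y where "y = (\<Sum>J\<in>Orb. frag_cmul (coef \<alpha> (rep J) div mult (rep J)) (frag_of J))"
  have coef_y: "coef y J = (if J \<in> Orb then coef \<alpha> (rep J) div mult (rep J) else 0)" for J
    by (simp add: y_def lookup_sum if_distrib[where f = "\<lambda>x. _ * x"] cong: if_cong)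
  show y: "y \<in> root_lattice Orb" by (simp add: mem_root_lattice_iff coef_y)
  have "coef y (orb k) * mult k = coef \<alpha> k" if "k \<in> V" for k
  proof -
    have "rep (orb k) \<in> orb k"
      unfolding rep_def by (rule someI[of _ k]) (simp add: vorbit_def)
    then have "rep (orb k) = k \<or> rep (orb k) = \<pi> k" by (simp add: vorbit_def)
    then have "coef \<alpha> (rep (orb k)) = coef \<alpha> k" "mult (rep (orb k)) = mult k"
      using that assms by (auto simp: mem_Sym_iff)
    then show ?thesis using that assms by (simp add: coef_y mem_Sym_iff)
  qed
  then show "\<phi> y = \<alpha>"
    using assms by (intro poly_mapping_eqI) (auto simp: lookup_phi[OF y] mult.commute mem_Sym_iff mem_root_lattice_iff)
qed

lemma act_Sym: "\<alpha> \<in> Sym \<Longrightarrow> act \<pi> \<alpha> = \<alpha>"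
  by (rule poly_mapping_eqI) (auto simp: mem_Sym_iff lookup_act mem_root_lattice_iff)

lemma add_act_Sym: "\<alpha> \<in> root_lattice V \<Longrightarrow> \<alpha> + act \<pi> \<alpha> \<in> Sym"
  using act_root_lattice[of \<alpha>]
  by (auto simp: mem_Sym_iff lookup_add lookup_act mult_def mem_root_lattice_iff[of "\<alpha> + act \<pi> \<alpha>"])
     (auto simp: mem_root_lattice_iff)

lemma bar_Sym: "\<alpha> \<in> root_lattice V \<Longrightarrow> bar \<alpha> \<in> Sym"
  using add_act_Sym by (simp add: symmetrize_def)

lemma phi_simple:
  assumes "i \<in> V" shows "\<phi> (frag_of (orb i)) = bar (frag_of i)"
proof (rule poly_mapping_eqI)
  fix k
  have lat: "frag_of i \<in> root_lattice V" using assms by (auto simp: mem_root_lattice_iff)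
  have "frag_of i \<in> Sym \<longleftrightarrow> \<pi> i = i \<and> mult i = 1"
    using assms lat by (auto simp: mem_Sym_iff pi_eq_swap mult_def)
  then show "coef (\<phi> (frag_of (orb i))) k = coef (bar (frag_of i)) k"
    using assms lat orb_eq_iff[of i k]
    by (auto simp: lookup_orbit_beta symmetrize_def lookup_add lookup_act mult_def pi_eq_swap)
qed


section \<open>The Cartan matrix of the folded graph\<close>

text \<open>An orbit of edges is determined by any of its members, since \<open>\<pi>\<close> is an involution.\<close>

lemma edge_orbit_eq:
  assumes "c \<in> edge_orbits E \<pi>" "{a, b} \<in> c"
  shows "{a, b} \<in> E \<and> c = {{a, b}, {\<pi> a, \<pi> b}}"
proof -
  obtain e where e: "e \<in> E" "c = {e, \<pi> ` e}" using assms by (auto simp: edge_orbits_def)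
  obtain u v where uv: "u \<in> V" "v \<in> V" "e = {u, v}"
    using e graph unfolding simple_graph_def by blast
  have E: "{\<pi> u, \<pi> v} \<in> E" using e(1) uv pi_edge[OF uv(1,2)] by simp
  have "{a, b} = {u, v} \<or> {a, b} = {\<pi> u, \<pi> v}" using e uv assms(2) by simp
  then show ?thesis
  proof
    assume "{a, b} = {u, v}"
    from arg_cong[OF this, of "image \<pi>"] have "{\<pi> a, \<pi> b} = {\<pi> u, \<pi> v}" by simp
    with \<open>{a, b} = {u, v}\<close> show ?thesis using e uv by simp
  next
    assume ab: "{a, b} = {\<pi> u, \<pi> v}"
    from arg_cong[OF this, of "image \<pi>"]
    have piab: "{\<pi> a, \<pi> b} = {u, v}" using uv by simp
    have "c = {{u, v}, {\<pi> u, \<pi> v}}" using e uv by simp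
    also have "\<dots> = {{\<pi> u, \<pi> v}, {u, v}}" by (rule insert_commute)
    finally show ?thesis unfolding ab piab using E by blast
  qed
qed

lemma edge_orbit_mem: "{a, b} \<in> E \<Longrightarrow> {{a, b}, {\<pi> a, \<pi> b}} \<in> edge_orbits E \<pi>"
  unfolding edge_orbits_def by (rule image_eqI[of _ _ "{a, b}"]) auto

lemma double_edges_iff:
  assumes "i \<in> V" "j \<in> V"
  shows "double_edges V E \<pi> \<sigma> (orb i) (orb j) \<noteq> {} \<longleftrightarrow>
    j \<in> nbrs i \<and> (\<pi> i \<noteq> i \<and> \<pi> j = j \<and> \<sigma> j = 1 \<or> \<pi> i = i \<and> \<pi> j \<noteq> j \<and> \<sigma> i = -1)"
    (is "?L \<longleftrightarrow> ?R")
proof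
  assume ?L
  then obtain c a b where c: "c \<in> edge_orbits E \<pi>" "{a, b} \<in> c"
    and ab: "a \<in> V" "\<pi> a \<noteq> a" "b \<in> V" "\<pi> b = b"
    and "\<sigma> b = 1 \<and> orb i = orb a \<and> orb j = orb b \<or> \<sigma> b = -1 \<and> orb i = orb b \<and> orb j = orb a"
    by (auto simp: double_edges_def fixed_iff)
  moreover have "{a, b} \<in> E" using edge_orbit_eq[OF c] by simp
  then have "b \<in> nbrs a" "b \<in> nbrs (\<pi> a)" "a \<in> nbrs b" "\<pi> a \<in> nbrs b"
    using pi_edge[of a b] ab by (auto simp: nbrs_iff insert_commute)
  ultimately show ?R using assms by (auto simp: orb_eq_iff)
next
  assume R: ?R
  then have "{i, j} \<in> E" "{j, i} \<in> E" by (simp_all add: nbrs_iff insert_commute)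
  note c = edge_orbit_mem[OF this(1)] edge_orbit_mem[OF this(2)]
  from R consider "\<pi> i \<noteq> i" "\<pi> j = j" "\<sigma> j = 1" | "\<pi> i = i" "\<pi> j \<noteq> j" "\<sigma> i = -1" by blast
  then show ?L
  proof cases
    case 1
    have "{{i, j}, {\<pi> i, \<pi> j}} \<in> double_edges V E \<pi> \<sigma> (orb i) (orb j)"
      unfolding double_edges_def
      by (intro CollectI conjI c(1) bexI[of _ i] bexI[of _ j]) (simp_all add: 1 assms fixed_iff)
    then show ?thesis by blast
  next
    case 2
    have "{{j, i}, {\<pi> j, \<pi> i}} \<in> double_edges V E \<pi> \<sigma> (orb i) (orb j)"
      unfolding double_edges_def
      by (intro CollectI conjI c(2) bexI[of _ j] bexI[of _ i]) (simp_all add: 2 assms fixed_iff)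
    then show ?thesis by blast
  qed
qed

lemma simple_edges_fixed:
  assumes "i \<in> V" "j \<in> V" "\<pi> i = i \<or> \<pi> j = j"
  shows "simple_edges V E \<pi> (orb i) (orb j) = {}"
  using assms by (auto simp: simple_edges_def fixed_iff orb_eq_iff)

text \<open>Every orbit of edges between the two vertex orbits contains an edge at \<open>i\<close>, and only one: the
  other edge of the orbit is at \<open>\<pi> i\<close>, and \<open>i\<close> and \<open>\<pi> i\<close> are not adjacent.\<close>

lemma card_simple_edges:
  assumes "i \<in> V" "j \<in> V" "\<pi> i \<noteq> i" "\<pi> j \<noteq> j" "orb i \<noteq> orb j"
  shows "card (simple_edges V E \<pi> (orb i) (orb j)) = card {k \<in> nbrs i. orb k = orb j}"
proof -
  let ?N = "{k \<in> nbrs i. orb k = orb j}" and ?f = "\<lambda>k. {{i, k}, {\<pi> i, \<pi> k}}"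
  have nonfixed: "\<pi> k \<noteq> k" if "k \<in> ?N" for k
    using that assms nbrs_V[of k i] by (auto simp: orb_eq_iff)
  have "simple_edges V E \<pi> (orb i) (orb j) = ?f ` ?N"
  proof (intro equalityI subsetI)
    fix c assume "c \<in> simple_edges V E \<pi> (orb i) (orb j)"
    then obtain a b where c: "c \<in> edge_orbits E \<pi>" "{a, b} \<in> c"
      and ab: "a \<in> V" "b \<in> V" "orb i = orb a" "orb j = orb b"
      by (auto simp: simple_edges_def)
    have e: "{a, b} \<in> E" "c = {{a, b}, {\<pi> a, \<pi> b}}" using edge_orbit_eq[OF c] by auto
    show "c \<in> ?f ` ?N"
    proof (cases "a = i")
      case True then show ?thesis using e ab by (auto simp: nbrs_iff)
    next
      case False
      then have a: "a = \<pi> i" "\<pi> a = i" using ab assms by (auto simp: orb_eq_iff)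
      have "\<pi> b \<in> nbrs i" using e pi_edge[of a b] ab a by (simp add: nbrs_iff)
      moreover have "c = ?f (\<pi> b)" unfolding e(2) a pi_pi[OF assms(1)] pi_pi[OF ab(2)]
        by (rule insert_commute)
      moreover have "orb (\<pi> b) = orb j" using ab by simp
      ultimately show ?thesis by blast
    qed
  next
    fix c assume "c \<in> ?f ` ?N"
    then obtain k where k: "k \<in> ?N" "c = ?f k" by auto
    then have "c \<in> edge_orbits E \<pi>" using edge_orbit_mem[of i k] by (simp add: nbrs_iff)
    moreover have "k \<in> V" "orb j = orb k" using k(1) nbrs_V[of k i] by simp_all
    ultimately show "c \<in> simple_edges V E \<pi> (orb i) (orb j)"
      unfolding simple_edges_def
      by (intro CollectI conjI bexI[of _ i] bexI[of _ k])
        (use k(2) nonfixed[OF k(1)] assms in \<open>simp_all add: fixed_iff\<close>)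
  qed
  moreover have "inj_on ?f ?N"
  proof (rule inj_onI)
    fix k l assume kl: "k \<in> ?N" "l \<in> ?N" "?f k = ?f l"
    have "{i, k} \<in> ?f l" unfolding kl(3)[symmetric] by simp
    moreover have "{i, k} \<noteq> {\<pi> i, \<pi> l}"
    proof
      assume "{i, k} = {\<pi> i, \<pi> l}"
      then have "\<pi> i \<in> {i, k}" by blast
      moreover have "k \<noteq> \<pi> i" using kl(1) pi_not_nbr[OF assms(1)] by blast
      ultimately show False using assms(3) by simp
    qed
    ultimately have "{i, k} = {i, l}" by blast
    then show "k = l" unfolding doubleton_eq_iff by blast
  qed
  ultimately show ?thesis by (simp add: card_image)
qed

text \<open>The factor \<open>mult i\<close> and the weights \<open>mult k\<close> absorb the orientation of the double edges. Between a
  nonfixed \<open>i\<close> and a fixed neighbour \<open>j\<close> the right hand side is \<open>-mult j\<close>, that is \<open>-1\<close> for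
  \<open>i \<Rightarrow> j\<close> and \<open>-2\<close> for \<open>j \<Rightarrow> i\<close>. Seen from a fixed \<open>i\<close>, both vertices of the orbit of \<open>j\<close> are
  neighbours and the right hand side is \<open>-2\<close>, which is \<open>-2 mult i\<close> or \<open>-mult i\<close> according to the
  sign at \<open>i\<close>. Two fixed vertices are never adjacent.\<close>

lemma cartan_row:
  assumes "i \<in> V" "J \<in> Orb"
  shows "mult i * A (orb i) J
           = (if J = orb i then 2 * mult i else 0) - (\<Sum>k | k \<in> nbrs i \<and> orb k = J. mult k)"
proof -
  obtain j where j: "j \<in> V" "J = orb j" using assms by auto
  show ?thesis
  proof (cases "orb i = orb j")
    case True
    have "orb k \<noteq> J" if "k \<in> nbrs i" for k
    proof
      assume "orb k = J"
      then have "orb k = orb i" using True j by (simp only:)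
      then have "k = i \<or> k = \<pi> i" using orb_eq_iff[OF nbrs_V[OF that] assms(1)] by blast
      then show False using that pi_not_nbr[OF assms(1)] not_nbrs_self by blast
    qed
    then have "{k. k \<in> nbrs i \<and> orb k = J} = {}" by blast
    then show ?thesis using True j by (simp only:) (simp add: folded_cartan_def)
  next
    case False
    let ?N = "{k. k \<in> nbrs i \<and> orb k = J}"
    have mem: "k \<in> ?N \<longleftrightarrow> k \<in> nbrs i \<and> (k = j \<or> k = \<pi> j)" for k
      using nbrs_V[of k i] orb_eq_iff[of k j] j by auto
    have ji: "i \<in> nbrs j \<longleftrightarrow> j \<in> nbrs i" by (rule nbrs_sym)
    note simps = folded_cartan_def double_edges_iff assms(1) j ji
    consider "\<pi> i \<noteq> i" "\<pi> j \<noteq> j" | "\<pi> i \<noteq> i" "\<pi> j = j" | "\<pi> i = i" "\<pi> j \<noteq> j" | "\<pi> i = i" "\<pi> j = j"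
      by blast
    then show ?thesis
    proof cases
      case 1
      have "(\<Sum>k\<in>?N. mult k) = (\<Sum>k\<in>?N. 1)"
        using mem 1 j by (intro sum.cong refl) (auto simp: mult_def)
      also have "\<dots> = int (card (simple_edges V E \<pi> (orb i) (orb j)))"
        using card_simple_edges[OF assms(1) j(1) 1 False] j by simp
      finally show ?thesis using 1 False by (simp add: simps mult_def)
    next
      case 2
      have "?N = (if j \<in> nbrs i then {j} else {})" using mem 2 by auto
      then show ?thesis using 2 False sign_cases[of j] simple_edges_fixed[of i j]
        by (simp only:) (auto simp: simps mult_def)
    next
      case 3
      have "?N = (if j \<in> nbrs i then {j, \<pi> j} else {})"
        using mem 3 pi_nbrs_iff[of i j] assms j by auto
      then show ?thesis using 3 False sign_cases[of i] simple_edges_fixed[of i j]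
        by (simp only:) (auto simp: simps mult_def)
    next
      case 4
      have "?N = {}" using mem 4 fixed_not_nbr[of i j] by auto
      then show ?thesis using 4 False simple_edges_fixed[of i j]
        by (simp only:) (simp add: simps)
    qed
  qed
qed

lemma cartan_nonzero_iff:
  assumes "i \<in> V" "J \<in> Orb"
  shows "A (orb i) J \<noteq> 0 \<longleftrightarrow> J = orb i \<or> (\<exists>k\<in>nbrs i. orb k = J)"
proof (cases "J = orb i")
  case True then show ?thesis by (simp add: folded_cartan_def)
next
  case False
  let ?N = "{k. k \<in> nbrs i \<and> orb k = J}"
  have fin: "finite ?N" by (rule finite_subset[of _ "nbrs i"]) auto
  have "A (orb i) J \<noteq> 0 \<longleftrightarrow> (\<Sum>k\<in>?N. mult k) \<noteq> 0"
  proof -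
    have row: "mult i * A (orb i) J = - (\<Sum>k\<in>?N. mult k)"
      unfolding cartan_row[OF assms] using False by (simp only: if_False diff_0)
    have "mult i \<noteq> 0" using mult_pos[of i] by linarith
    then have "A (orb i) J = 0 \<longleftrightarrow> mult i * A (orb i) J = 0" by simp
    also have "\<dots> \<longleftrightarrow> (\<Sum>k\<in>?N. mult k) = 0" unfolding row by (rule neg_equal_0_iff_equal)
    finally show ?thesis by blast
  qed
  also have "\<dots> \<longleftrightarrow> ?N \<noteq> {}"
  proof
    assume "(\<Sum>k\<in>?N. mult k) \<noteq> 0"
    then show "?N \<noteq> {}" by (rule contrapos_nn) (simp only: sum.empty)
  next
    assume "?N \<noteq> {}"
    then have "0 < (\<Sum>k\<in>?N. mult k)" by (intro sum_pos fin mult_pos)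
    then show "(\<Sum>k\<in>?N. mult k) \<noteq> 0" by simp
  qed
  finally show ?thesis using False by blast
qed

lemma pairing_phi:
  assumes y: "y \<in> root_lattice Orb" and i: "i \<in> V"
  shows "pairing (\<phi> y) i = mult i * coroot_pairing Orb A y (orb i)"
proof -
  have "(\<Sum>k\<in>nbrs i. coef (\<phi> y) k) = (\<Sum>k\<in>nbrs i. mult k * coef y (orb k))"
    by (intro sum.cong refl) (simp add: lookup_phi[OF y] nbrs_V)
  also have "\<dots> = (\<Sum>J\<in>Orb. \<Sum>k | k \<in> nbrs i \<and> orb k = J. mult k * coef y (orb k))"
    by (intro sum.group[symmetric]) (auto dest: nbrs_V)
  also have "\<dots> = (\<Sum>J\<in>Orb. (\<Sum>k | k \<in> nbrs i \<and> orb k = J. mult k) * coef y J)"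
    unfolding sum_distrib_right by (intro sum.cong refl) auto
  finally have nb: "(\<Sum>k\<in>nbrs i. coef (\<phi> y) k) = \<dots>" .
  have "mult i * coroot_pairing Orb A y (orb i) = (\<Sum>J\<in>Orb. (mult i * A (orb i) J) * coef y J)"
    by (simp add: coroot_pairing_def sum_distrib_left mult.assoc)
  also have "\<dots> = (\<Sum>J\<in>Orb. (if J = orb i then 2 * mult i * coef y J else 0)
                     - (\<Sum>k | k \<in> nbrs i \<and> orb k = J. mult k) * coef y J)"
    by (intro sum.cong refl) (simp add: cartan_row[OF i] left_diff_distrib)
  also have "\<dots> = 2 * mult i * coef y (orb i)
                   - (\<Sum>J\<in>Orb. (\<Sum>k | k \<in> nbrs i \<and> orb k = J. mult k) * coef y J)"
    using i by (simp add: sum_subtractf)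
  also have "\<dots> = pairing (\<phi> y) i"
    unfolding pairing_def nb using i by (simp add: lookup_phi[OF y])
  finally show ?thesis ..
qed


section \<open>Folded reflections\<close>

text \<open>The element of the Weyl group of the graph that realises the simple reflection of the folded graph
  at the orbit of \<open>i\<close>.\<close>

definition s :: "'a \<Rightarrow> ('a \<Rightarrow>\<^sub>0 int) \<Rightarrow> ('a \<Rightarrow>\<^sub>0 int)" where
  "s i = (if \<pi> i = i then r i else r i \<circ> r (\<pi> i))"

lemma lookup_s:
  assumes "i \<in> V"
  shows "coef (s i \<alpha>) k = coef \<alpha> k - (if k \<in> orb i then pairing \<alpha> k else 0)"
  using assms pi_not_nbr[OF assms]
  by (auto simp: s_def lookup_r r_eq vorbit_def pairing_linear pairing_frag_of lookup_minus)

lemma s_in_W: "i \<in> V \<Longrightarrow> s i \<in> W"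
  by (simp add: s_def W_comp del: comp_apply)

lemma s_s:
  assumes "i \<in> V" shows "s i (s i \<alpha>) = \<alpha>"
proof (cases "\<pi> i = i")
  case False
  have "\<pi> i \<notin> nbrs i" using pi_not_nbr assms by blast
  then have "r i \<circ> r (\<pi> i) = r (\<pi> i) \<circ> r i" using False assms by (intro r_commute) auto
  then have "r i (r (\<pi> i) \<beta>) = r (\<pi> i) (r i \<beta>)" for \<beta> by (simp add: fun_eq_iff)
  then show ?thesis using False assms by (simp add: s_def)
qed (use assms in \<open>simp add: s_def\<close>)

lemma km_reflection_root_lattice:
  "y \<in> root_lattice Orb \<Longrightarrow> J \<in> Orb \<Longrightarrow> km_reflection Orb A J y \<in> root_lattice Orb"
  by (auto simp: mem_root_lattice_iff km_reflection_def lookup_minus)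

lemma phi_km_reflection:
  assumes y: "y \<in> root_lattice Orb" and i: "i \<in> V"
  shows "\<phi> (km_reflection Orb A (orb i) y) = s i (\<phi> y)"
proof (rule poly_mapping_eqI)
  fix k
  have "km_reflection Orb A (orb i) y \<in> root_lattice Orb"
    using y i by (intro km_reflection_root_lattice) auto
  then show "coef (\<phi> (km_reflection Orb A (orb i) y)) k = coef (s i (\<phi> y)) k"
    using mem_orb[OF i, of k]
    by (auto simp: lookup_phi lookup_s[OF i] pairing_phi[OF y] y km_reflection_def lookup_minus
        algebra_simps)
qed

text \<open>Evenness at the fixed vertices of sign \<open>-1\<close> would require a count of neighbours; it is
  read off from the parametrization by \<open>\<phi>\<close> instead.\<close>

lemma s_Sym: "\<alpha> \<in> Sym \<Longrightarrow> i \<in> V \<Longrightarrow> s i \<alpha> \<in> Sym"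
  using Sym_phi[of \<alpha>] phi_km_reflection phi_Sym km_reflection_root_lattice
  by (metis image_eqI)

lemma pairing_act:
  assumes \<alpha>: "\<alpha> \<in> root_lattice V" and k: "k \<in> V"
  shows "pairing (act \<pi> \<alpha>) k = pairing \<alpha> (\<pi> k)"
proof -
  have "inj_on \<pi> (nbrs k)" by (rule inj_onI) (metis nbrs_V pi_pi)
  then have "(\<Sum>j\<in>nbrs (\<pi> k). coef \<alpha> j) = (\<Sum>j\<in>nbrs k. coef \<alpha> (\<pi> j))"
    using k by (simp add: nbrs_pi sum.reindex)
  also have "\<dots> = (\<Sum>j\<in>nbrs k. coef (act \<pi> \<alpha>) j)"
    by (intro sum.cong refl) (simp add: lookup_act \<alpha> nbrs_V)
  finally show ?thesis using k by (simp add: pairing_def lookup_act \<alpha>)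
qed

lemma act_s:
  assumes \<alpha>: "\<alpha> \<in> root_lattice V" and i: "i \<in> V"
  shows "act \<pi> (s i \<alpha>) = s i (act \<pi> \<alpha>)"
proof (rule poly_mapping_eqI)
  fix k
  have "s i \<alpha> \<in> root_lattice V" using \<alpha> i W_root_lattice s_in_W by blast
  then show "coef (act \<pi> (s i \<alpha>)) k = coef (s i (act \<pi> \<alpha>)) k"
    using mem_orb[OF i, of k] mem_orb[OF i, of "\<pi> k"]
    by (auto simp: lookup_act \<alpha> lookup_s[OF i] pairing_act)
qed

lemma bar_s:
  assumes \<alpha>: "\<alpha> \<in> root_lattice V" and i: "i \<in> V"
  shows "bar (s i \<alpha>) = s i (bar \<alpha>)"
proof -
  have "s i \<alpha> \<in> Sym \<longleftrightarrow> \<alpha> \<in> Sym" using s_Sym[OF _ i] s_s[OF i] by metis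
  then show ?thesis
    using W_add[OF s_in_W[OF i]] act_s[OF assms] by (simp add: symmetrize_def)
qed

text \<open>Folded reflections act on \<open>root_lattice Orb\<close> like products of the \<open>s\<^sub>i\<close>. The lift is an
  element of \<open>W\<close>, which gives access to the theory of the original graph, and it still commutes with
  \<open>bar\<close>, which a general element of \<open>W\<close> does not.\<close>

lemma km_weyl_lift:
  assumes "w \<in> km_weyl Orb A"
  obtains v where "v \<in> W" "\<And>y. y \<in> root_lattice Orb \<Longrightarrow> w y \<in> root_lattice Orb"
    "\<And>y. y \<in> root_lattice Orb \<Longrightarrow> \<phi> (w y) = v (\<phi> y)"
    "\<And>\<alpha>. \<alpha> \<in> root_lattice V \<Longrightarrow> bar (v \<alpha>) = v (bar \<alpha>)"
proof -
  have "\<exists>v\<in>W. (\<forall>y\<in>root_lattice Orb. w y \<in> root_lattice Orb \<and> \<phi> (w y) = v (\<phi> y)) \<and>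
    (\<forall>\<alpha>\<in>root_lattice V. bar (v \<alpha>) = v (bar \<alpha>))"
    using assms unfolding km_weyl_def
  proof induction
    case id
    then show ?case by (intro bexI[of _ id]) auto
  next
    case (comp t w)
    then obtain i v where "i \<in> V" "t = km_reflection Orb A (orb i)" "v \<in> W"
      "\<forall>y\<in>root_lattice Orb. w y \<in> root_lattice Orb \<and> \<phi> (w y) = v (\<phi> y)"
      "\<forall>\<alpha>\<in>root_lattice V. bar (v \<alpha>) = v (bar \<alpha>)" by auto
    then show ?case
      by (intro bexI[of _ "s i \<circ> v"] W_comp)
         (auto simp: phi_km_reflection bar_s W_root_lattice s_in_W km_reflection_root_lattice)
  qed
  then show ?thesis using that by blast
qed


section \<open>Fundamental vectors\<close>

text \<open>Let \<open>S\<close> be the support of \<open>\<alpha> = \<phi> y\<close> and \<open>C\<close> one of its components. Since the support of \<open>y\<close> is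
  connected in the folded graph, every orbit in \<open>S\<close> meets \<open>C\<close>. So \<open>C = S\<close>, or \<open>S\<close> is the disjoint
  union of \<open>C\<close> and \<open>\<pi> C\<close>. The restriction \<open>\<gamma>\<close> of \<open>\<alpha>\<close> to \<open>C\<close> is fundamental because no edge joins
  \<open>C\<close> to the rest of \<open>S\<close>. In the first case \<open>\<gamma> = \<alpha>\<close> is symmetric, in the second \<open>\<gamma>\<close> is not symmetric
  and \<open>\<gamma> + \<pi> \<gamma> = \<alpha>\<close>.\<close>

lemma fundamental_phi_bar:
  assumes y: "y \<in> km_fundamental Orb A"
  obtains \<gamma> where "\<gamma> \<in> gfundamental V E" "\<phi> y = bar \<gamma>"
proof -
  let ?adj = "\<lambda>u v. {u, v} \<in> E"
  have lat: "y \<in> root_lattice Orb" and y0: "\<And>J. 0 \<le> coef y J" "y \<noteq> 0"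
    and conn: "connected_subset (\<lambda>I J. A I J \<noteq> 0) (Poly_Mapping.keys y)"
    and dom: "\<And>J. J \<in> Orb \<Longrightarrow> coroot_pairing Orb A y J \<le> 0"
    using y by (auto simp: km_fundamental_def mem_root_lattice_pos_iff)
  define S where "S = {k \<in> V. orb k \<in> Poly_Mapping.keys y}"
  define \<alpha> where "\<alpha> = \<phi> y"
  have \<alpha>_Sym: "\<alpha> \<in> Sym" using phi_Sym[OF lat] by (simp add: \<alpha>_def)
  have S_iff: "k \<in> S \<longleftrightarrow> coef \<alpha> k \<noteq> 0" for k
    using mult_pos[of k] by (auto simp: S_def \<alpha>_def lookup_phi[OF lat] in_keys_iff)
  have \<alpha>0: "0 \<le> coef \<alpha> k" for k
    using y0(1) mult_pos[of k] by (simp add: \<alpha>_def lookup_phi[OF lat] zero_le_mult_iff less_imp_le)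
  have S_pi: "\<pi> k \<in> S" if "k \<in> S" for k using that by (auto simp: S_def)
  have SV: "S \<subseteq> V" by (auto simp: S_def)
  have keys_Orb: "Poly_Mapping.keys y \<subseteq> Orb" using lat by (simp add: root_lattice_def)
  have "Poly_Mapping.keys y \<noteq> {}" using y0(2) by simp
  then obtain a where a: "a \<in> S" using keys_Orb unfolding S_def by blast
  let ?R = "{(x, y). x \<in> S \<and> y \<in> S \<and> ?adj x y}"
  define C where "C = {x. (a, x) \<in> ?R\<^sup>*}"
  have adj_sym: "?adj v u" if "?adj u v" for u v using that by (simp only: insert_commute)
  have C: "C \<subseteq> S" "a \<in> C" "connected_subset ?adj C"
    "\<And>x y. x \<in> C \<Longrightarrow> y \<in> S \<Longrightarrow> ?adj x y \<Longrightarrow> y \<in> C"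
    using component_connected[of ?adj, OF adj_sym a] unfolding C_def by blast+
  \<comment> \<open>A path of orbits from \<open>orb a\<close> lifts to a path in \<open>S\<close> that starts at \<open>a\<close>.\<close>
  have meets: "k \<in> C \<or> \<pi> k \<in> C" if "k \<in> S" for k
  proof -
    have "(orb a, orb k) \<in> {(I, J). I \<in> Poly_Mapping.keys y \<and> J \<in> Poly_Mapping.keys y \<and> A I J \<noteq> 0}\<^sup>*"
      using conn a that by (auto simp: connected_subset_def S_def)
    then have "\<exists>l\<in>C. orb l = orb k"
    proof induction
      case base then show ?case using C(2) by blast
    next
      case (step I J)
      then obtain l where l: "l \<in> C" "orb l = I" by blast
      have J: "J \<in> Orb" "J \<in> Poly_Mapping.keys y" using step keys_Orb by auto
      have "l \<in> V" using l C(1) SV by blast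
      then consider "J = orb l" | m where "m \<in> nbrs l" "orb m = J"
        using cartan_nonzero_iff[of l J] J step l by auto
      then show ?case
      proof cases
        case 2
        then have "m \<in> S" using J nbrs_V by (auto simp: S_def)
        then have "m \<in> C" using C(4)[OF l(1)] 2 by (simp add: nbrs_iff)
        then show ?thesis using 2 by blast
      qed (use l in auto)
    qed
    then obtain l where "l \<in> C" "orb l = orb k" by blast
    then show ?thesis using that C(1) SV orb_eq_iff[of l k] by auto
  qed
  have R_sym: "sym (?R\<^sup>*)" by (intro sym_rtrancl) (auto simp: sym_def intro: adj_sym)
  have R_pi: "(\<pi> u, \<pi> v) \<in> ?R\<^sup>*" if "(u, v) \<in> ?R\<^sup>*" for u v
  proof (rule rtrancl_map[OF _ that])
    fix x y assume xy: "(x, y) \<in> ?R"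
    then have "x \<in> V" "y \<in> V" using SV by auto
    then show "(\<pi> x, \<pi> y) \<in> ?R" using xy S_pi pi_edge[of x y] by simp
  qed
  \<comment> \<open>If \<open>C\<close> meets \<open>\<pi> C\<close>, it is stable under \<open>\<pi>\<close>.\<close>
  have C_S: "C = S" if k: "k \<in> C" "\<pi> k \<in> C" for k
  proof -
    have "\<pi> x \<in> C" if x: "x \<in> C" for x
    proof -
      have "(k, a) \<in> ?R\<^sup>*" using k(1) R_sym by (auto simp: C_def dest: symD)
      then have "(k, x) \<in> ?R\<^sup>*" using x by (auto simp: C_def)
      from R_pi[OF this] show ?thesis using k(2) by (auto simp: C_def)
    qed
    then have "x \<in> C" if "x \<in> S" for x using meets[OF that] that SV pi_pi by (metis subsetD)
    then show ?thesis using C(1) by blast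
  qed
  define \<gamma> where "\<gamma> = (\<Sum>k\<in>C. frag_cmul (coef \<alpha> k) (frag_of k))"
  have finC: "finite C" by (rule finite_subset[OF subset_trans[OF C(1) SV] finite_V])
  have coef_\<gamma>: "coef \<gamma> k = (if k \<in> C then coef \<alpha> k else 0)" for k
    using finC by (simp add: \<gamma>_def lookup_sum if_distrib[where f = "\<lambda>x. _ * x"] cong: if_cong)
  have \<gamma>_lat: "\<gamma> \<in> root_lattice V" using C(1) SV by (auto simp: mem_root_lattice_iff coef_\<gamma>)
  have keys_\<gamma>: "Poly_Mapping.keys \<gamma> = C" using C(1) S_iff by (auto simp: in_keys_iff coef_\<gamma> split: if_splits)
  have "pairing \<gamma> i \<le> 0" if i: "i \<in> V" for i
  proof (cases "i \<in> C")
    case True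
    have "coef \<gamma> j = coef \<alpha> j" if "j \<in> nbrs i" for j
      using C(4)[OF True, of j] that S_iff by (auto simp: coef_\<gamma> nbrs_iff)
    then have "pairing \<gamma> i = pairing \<alpha> i" using True by (simp add: pairing_def coef_\<gamma>)
    also have "\<dots> \<le> 0"
      unfolding \<alpha>_def pairing_phi[OF lat i]
      by (intro mult_nonneg_nonpos less_imp_le[OF mult_pos] dom imageI i)
    finally show ?thesis .
  next
    case False
    have "0 \<le> (\<Sum>j\<in>nbrs i. coef \<gamma> j)" by (intro sum_nonneg) (simp add: coef_\<gamma> \<alpha>0)
    then show ?thesis using False by (simp add: pairing_def coef_\<gamma>)
  qed
  moreover have "\<gamma> \<noteq> 0" using keys_\<gamma> C(2) by auto
  ultimately have "\<gamma> \<in> gfundamental V E"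
    using C(3) \<gamma>_lat \<alpha>0 by (simp add: gfundamental_iff keys_\<gamma> mem_root_lattice_pos_iff coef_\<gamma>)
  moreover have "\<alpha> = bar \<gamma>"
  proof (cases "C = S")
    case True
    then have "\<gamma> = \<alpha>" using S_iff by (auto intro!: poly_mapping_eqI simp: coef_\<gamma>)
    then show ?thesis using \<alpha>_Sym by (simp add: symmetrize_def)
  next
    case False
    have aV: "a \<in> V" using a SV by blast
    have "\<pi> a \<notin> C" using C_S[OF C(2)] False by blast
    then have "coef \<gamma> (\<pi> a) \<noteq> coef \<gamma> a" using C(2) a S_iff by (simp add: coef_\<gamma>)
    then have "\<gamma> \<notin> Sym" using aV by (auto simp: mem_Sym_iff)
    moreover have "\<alpha> = \<gamma> + act \<pi> \<gamma>"
    proof (rule poly_mapping_eqI)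
      fix k
      show "coef \<alpha> k = coef (\<gamma> + act \<pi> \<gamma>) k"
      proof (cases "k \<in> S")
        case True
        then have "k \<in> V" "k \<in> C \<longleftrightarrow> \<pi> k \<notin> C" using meets C_S False SV by blast+
        then show ?thesis using \<alpha>_Sym by (auto simp: lookup_add lookup_act[OF \<gamma>_lat] coef_\<gamma> mem_Sym_iff)
      next
        case nS: False
        then have "k \<notin> C" "k \<in> V \<Longrightarrow> \<pi> k \<notin> C" using C(1) S_pi[of "\<pi> k"] by auto
        then show ?thesis using nS S_iff[of k] by (simp add: lookup_add lookup_act[OF \<gamma>_lat] coef_\<gamma>)
      qed
    qed
    ultimately show ?thesis by (simp add: symmetrize_def)
  qed
  ultimately show ?thesis using that by (simp add: \<alpha>_def)
qed

lemma connected_orb: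
  assumes "S \<subseteq> V" "connected_subset (\<lambda>u v. {u, v} \<in> E) S"
  shows "connected_subset (\<lambda>I J. A I J \<noteq> 0) (orb ` S)"
proof -
  have "(orb u, orb v) \<in> {(I, J). I \<in> orb ` S \<and> J \<in> orb ` S \<and> A I J \<noteq> 0}\<^sup>*"
    if "u \<in> S" "v \<in> S" for u v
  proof (rule rtrancl_map[where f = orb, rotated])
    show "(u, v) \<in> {(x, y). x \<in> S \<and> y \<in> S \<and> {x, y} \<in> E}\<^sup>*"
      using assms that by (simp add: connected_subset_def)
    fix x y assume xy: "(x, y) \<in> {(x, y). x \<in> S \<and> y \<in> S \<and> {x, y} \<in> E}"
    then have "x \<in> V" "y \<in> V" "y \<in> nbrs x" using assms(1) by (auto simp: nbrs_iff)
    then have "A (orb x) (orb y) \<noteq> 0" using cartan_nonzero_iff[of x "orb y"] by blast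
    with xy show "(orb x, orb y) \<in> {(I, J). I \<in> orb ` S \<and> J \<in> orb ` S \<and> A I J \<noteq> 0}"
      by blast
  qed
  then show ?thesis by (auto simp: connected_subset_def)
qed

lemma pos_of_phi_pos:
  assumes "y \<in> root_lattice Orb" "\<phi> y \<in> pos" shows "y \<in> root_lattice_pos Orb"
proof -
  have "0 \<le> coef y (orb k)" if "k \<in> V" for k
  proof -
    have "0 \<le> coef (\<phi> y) k" using assms(2) by (simp add: mem_root_lattice_pos_iff)
    then show ?thesis using that mult_pos[of k] by (simp add: lookup_phi[OF assms(1)] zero_le_mult_iff)
  qed
  then show ?thesis using assms(1) by (auto simp: root_lattice_pos_def)
qed

lemma bar_pos:
  assumes "\<alpha> \<in> pos" shows "bar \<alpha> \<in> pos" "coef \<alpha> k \<le> coef (bar \<alpha>) k"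
  using assms bar_Sym[of \<alpha>]
  by (auto simp: mem_root_lattice_pos_iff mem_Sym_iff symmetrize_def lookup_add lookup_act)

text \<open>The hypothesis is on \<open>\<alpha> + \<pi> \<alpha>\<close> and not on \<open>bar \<alpha>\<close>, so that it reads the same for symmetric and
  nonsymmetric roots; for symmetric \<open>\<alpha>\<close> it is twice \<open>bar \<alpha>\<close>.\<close>

lemma antidominant_bar_fundamental:
  assumes \<alpha>: "\<alpha> \<in> gpos_roots V E" and dom: "\<forall>k\<in>V. pairing (\<alpha> + act \<pi> \<alpha>) k \<le> 0"
  obtains y where "y \<in> km_fundamental Orb A" "\<phi> y = bar \<alpha>"
proof -
  have pos: "\<alpha> \<in> pos" using gpos_roots_pos[OF \<alpha>] .
  have lat: "\<alpha> \<in> root_lattice V" using pos by (simp add: mem_root_lattice_pos_iff)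
  obtain y where y: "y \<in> root_lattice Orb" "\<phi> y = bar \<alpha>" using Sym_phi bar_Sym lat by metis
  have keys_y: "Poly_Mapping.keys y = orb ` Poly_Mapping.keys \<alpha>"
  proof (intro set_eqI iffI)
    fix J assume J: "J \<in> Poly_Mapping.keys y"
    then obtain k where k: "k \<in> V" "J = orb k" using y by (auto simp: root_lattice_def)
    have "coef (bar \<alpha>) k \<noteq> 0"
      using J k mult_pos[of k] by (simp add: y(2)[symmetric] lookup_phi[OF y(1)] in_keys_iff)
    then have "coef \<alpha> k \<noteq> 0 \<or> coef \<alpha> (\<pi> k) \<noteq> 0"
      by (auto simp: symmetrize_def lookup_add lookup_act[OF lat] split: if_splits)
    then show "J \<in> orb ` Poly_Mapping.keys \<alpha>"
      using k by (metis image_eqI in_keys_iff orb_pi)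
  next
    fix J assume "J \<in> orb ` Poly_Mapping.keys \<alpha>"
    then obtain k where k: "coef \<alpha> k \<noteq> 0" "J = orb k" by (auto simp: in_keys_iff)
    then have kV: "k \<in> V" using lat by (auto simp: mem_root_lattice_iff)
    have "0 < coef \<alpha> k" using k pos by (auto simp: mem_root_lattice_pos_iff less_le)
    also have "\<dots> \<le> coef (bar \<alpha>) k" by (rule bar_pos[OF pos])
    finally show "J \<in> Poly_Mapping.keys y"
      using k kV by (auto simp: y(2)[symmetric] lookup_phi[OF y(1)] in_keys_iff)
  qed
  have "pairing (bar \<alpha>) i \<le> 0" if "i \<in> V" for i
    using dom that act_Sym[of \<alpha>] by (auto simp: symmetrize_def pairing_linear)
  then have "coroot_pairing Orb A y (orb i) \<le> 0" if "i \<in> V" for i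
  proof -
    have "mult i * coroot_pairing Orb A y (orb i) \<le> 0"
      using \<open>\<And>i. i \<in> V \<Longrightarrow> pairing (bar \<alpha>) i \<le> 0\<close>[OF that] pairing_phi[OF y(1) that]
      by (simp only: y(2))
    then show ?thesis using mult_pos[of i] by (simp add: mult_le_0_iff less_imp_le not_le)
  qed
  moreover have "connected_subset (\<lambda>I J. A I J \<noteq> 0) (Poly_Mapping.keys y)"
    unfolding keys_y using lat gpos_roots_connected[OF \<alpha>]
    by (intro connected_orb) (auto simp: root_lattice_def)
  moreover have "y \<noteq> 0"
  proof
    assume "y = 0"
    then have "Poly_Mapping.keys \<alpha> = {}" using keys_y by simp
    then show False using gpos_roots_nonzero[OF \<alpha>] by (simp add: keys_eq_empty)
  qed
  moreover have "y \<in> root_lattice_pos Orb" using y bar_pos[OF pos] by (intro pos_of_phi_pos) auto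
  ultimately have "y \<in> km_fundamental Orb A" by (auto simp: km_fundamental_def)
  then show ?thesis using y that by blast
qed


section \<open>Comparison of the two root systems\<close>

lemma km_pos_roots_root_lattice:
  assumes "y \<in> km_pos_roots Orb A" shows "y \<in> root_lattice Orb"
proof -
  from assms consider "y \<in> root_lattice_pos Orb"
    | w z where "w \<in> km_weyl Orb A" "z \<in> km_fundamental Orb A" "y = w z"
    unfolding km_pos_roots_def by blast
  then show ?thesis
  proof cases
    case 1 then show ?thesis by (simp add: mem_root_lattice_pos_iff)
  next
    case 2
    then have "z \<in> root_lattice Orb" by (simp add: km_fundamental_def mem_root_lattice_pos_iff)
    then show ?thesis using km_weyl_lift[OF 2(1)] 2(3) by metis
  qed
qed

lemma km_pos_roots_reflection:
  assumes y: "y \<in> km_pos_roots Orb A" and J: "J \<in> Orb"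
    and pos: "km_reflection Orb A J y \<in> root_lattice_pos Orb"
  shows "km_reflection Orb A J y \<in> km_pos_roots Orb A"
proof -
  have comp: "km_reflection Orb A J \<circ> w \<in> km_weyl Orb A" if "w \<in> km_weyl Orb A" for w
    using that J unfolding km_weyl_def by (intro generated_by.comp) auto
  from y consider w K where "w \<in> km_weyl Orb A" "K \<in> Orb" "y = w (frag_of K)"
    | w z where "w \<in> km_weyl Orb A" "z \<in> km_fundamental Orb A" "y = w z"
    unfolding km_pos_roots_def by blast
  then show ?thesis
  proof cases
    case 1
    have "km_reflection Orb A J y = (km_reflection Orb A J \<circ> w) (frag_of K)" using 1 by simp
    then show ?thesis using comp[OF 1(1)] 1(2) pos unfolding km_pos_roots_def by blast
  next
    case 2
    have "km_reflection Orb A J y = (km_reflection Orb A J \<circ> w) z" using 2 by simp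
    then show ?thesis using comp[OF 2(1)] 2(2) unfolding km_pos_roots_def by blast
  qed
qed

lemma km_pos_roots_simple: "J \<in> Orb \<Longrightarrow> frag_of J \<in> km_pos_roots Orb A"
proof -
  assume J: "J \<in> Orb"
  then have "frag_of J = id (frag_of J)" "id \<in> km_weyl Orb A" "frag_of J \<in> root_lattice_pos Orb"
    by (auto simp: km_weyl_def generated_by.id mem_root_lattice_pos_iff mem_root_lattice_iff)
  then show ?thesis using J unfolding km_pos_roots_def by blast
qed

text \<open>Lift the Weyl group element and move it past \<open>bar\<close>. In the real case the sign of \<open>v \<epsilon>\<^sub>i\<close> has to
  be decided.\<close>

lemma phi_root_is_bar:
  assumes "y \<in> km_pos_roots Orb A"
  obtains \<alpha> where "\<alpha> \<in> gpos_roots V E" "\<phi> y = bar \<alpha>"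
proof -
  from assms consider
      (real) w i where "w \<in> km_weyl Orb A" "i \<in> V" "y = w (frag_of (orb i))" "y \<in> root_lattice_pos Orb"
    | (imag) w z where "w \<in> km_weyl Orb A" "z \<in> km_fundamental Orb A" "y = w z"
    unfolding km_pos_roots_def by blast
  then show ?thesis
  proof cases
    case real
    obtain v where v: "v \<in> W" "\<And>y. y \<in> root_lattice Orb \<Longrightarrow> \<phi> (w y) = v (\<phi> y)"
      "\<And>\<alpha>. \<alpha> \<in> root_lattice V \<Longrightarrow> bar (v \<alpha>) = v (bar \<alpha>)"
      using km_weyl_lift[OF real(1)] by metis
    define \<alpha> where "\<alpha> = v (frag_of i)"
    have lat: "frag_of i \<in> root_lattice V" "frag_of (orb i) \<in> root_lattice Orb"
      using real(2) by (auto simp: mem_root_lattice_iff)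
    have eq: "\<phi> y = bar \<alpha>"
      using v lat real phi_simple[OF real(2)] by (simp add: \<alpha>_def)
    have \<alpha>_lat: "\<alpha> \<in> root_lattice V" using W_root_lattice[OF v(1) lat(1)] by (simp add: \<alpha>_def)
    have "\<alpha> \<in> pos"
    proof (rule disjE[OF real_root_sign[OF v(1) real(2)]])
      \<comment> \<open>If \<open>\<alpha> \<le> 0\<close>, then \<open>0 \<le> \<phi> y = bar \<alpha> \<le> \<alpha>\<close>, so that \<open>\<alpha>\<close> is nonnegative after all.\<close>
      assume "- v (frag_of i) \<in> pos"
      then have neg: "coef \<alpha> k \<le> 0" for k by (simp add: \<alpha>_def mem_root_lattice_pos_iff)
      have y_lat: "y \<in> root_lattice Orb" using real(4) by (simp add: mem_root_lattice_pos_iff)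
      have "0 \<le> coef (bar \<alpha>) k" for k
        using real(4) mult_pos[of k]
        by (simp add: eq[symmetric] lookup_phi[OF y_lat] mem_root_lattice_pos_iff less_imp_le)
      moreover have "coef (bar \<alpha>) k \<le> coef \<alpha> k" for k
        using neg by (simp add: symmetrize_def lookup_add lookup_act[OF \<alpha>_lat])
      ultimately have "0 \<le> coef \<alpha> k" for k using order_trans by blast
      then show ?thesis using \<alpha>_lat by (simp add: mem_root_lattice_pos_iff)
    qed (simp add: \<alpha>_def)
    then have "\<alpha> \<in> gpos_roots V E" using W_simple[OF v(1) real(2)] by (simp add: \<alpha>_def)
    then show ?thesis using eq that by blast
  next
    case imag
    obtain v where v: "v \<in> W" "\<And>y. y \<in> root_lattice Orb \<Longrightarrow> \<phi> (w y) = v (\<phi> y)"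
      "\<And>\<alpha>. \<alpha> \<in> root_lattice V \<Longrightarrow> bar (v \<alpha>) = v (bar \<alpha>)"
      using km_weyl_lift[OF imag(1)] by metis
    obtain \<gamma> where \<gamma>: "\<gamma> \<in> gfundamental V E" "\<phi> z = bar \<gamma>"
      using fundamental_phi_bar[OF imag(2)] by metis
    have "z \<in> root_lattice Orb" "\<gamma> \<in> root_lattice V"
      using imag(2) \<gamma>(1) by (simp_all add: km_fundamental_def gfundamental_iff mem_root_lattice_pos_iff)
    then have "\<phi> y = bar (v \<gamma>)" using v \<gamma> imag by simp
    then show ?thesis using W_fundamental[OF v(1) \<gamma>(1)] that by blast
  qed
qed

text \<open>The pairing of \<open>\<alpha> + \<pi> \<alpha>\<close> with \<open>\<epsilon>\<^sub>i\<close> is \<open>pairing \<alpha> i + pairing \<alpha> (\<pi> i)\<close>. When it is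
  positive, \<open>s\<^sub>i\<close> lowers the height of \<open>\<alpha>\<close> by the sum of \<open>pairing \<alpha>\<close> over the orbit of \<open>i\<close>, which
  is this number, or half of it for a fixed \<open>i\<close>. Since \<open>bar\<close> commutes with \<open>s\<^sub>i\<close>, the folded root
  found for \<open>s\<^sub>i \<alpha>\<close> can be reflected back.\<close>

lemma bar_root_is_phi:
  assumes "\<alpha> \<in> gpos_roots V E"
  shows "\<exists>y\<in>km_pos_roots Orb A. \<phi> y = bar \<alpha>"
  using assms
proof (induction "height \<alpha>" arbitrary: \<alpha> rule: less_induct)
  case less
  have pos: "\<alpha> \<in> pos" and lat: "\<alpha> \<in> root_lattice V"
    using gpos_roots_pos[OF less.prems] by (simp_all add: mem_root_lattice_pos_iff)
  show ?case
  proof (cases "\<forall>k\<in>V. pairing (\<alpha> + act \<pi> \<alpha>) k \<le> 0")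
    case True
    then obtain y where "y \<in> km_fundamental Orb A" "\<phi> y = bar \<alpha>"
      using antidominant_bar_fundamental[OF less.prems] by metis
    moreover have "y = id y" "id \<in> km_weyl Orb A" by (auto simp: km_weyl_def generated_by.id)
    ultimately show ?thesis unfolding km_pos_roots_def by blast
  next
    case False
    then obtain i where i: "i \<in> V" "0 < pairing (\<alpha> + act \<pi> \<alpha>) i" by force
    show ?thesis
    proof (cases "\<alpha> = frag_of i \<or> \<alpha> = frag_of (\<pi> i)")
      case True
      then have "bar \<alpha> = \<phi> (frag_of (orb i))"
        using phi_simple[of i] phi_simple[of "\<pi> i"] i by auto
      moreover have "frag_of (orb i) \<in> km_pos_roots Orb A" using i by (intro km_pos_roots_simple imageI)
      ultimately show ?thesis by (intro bexI[of _ "frag_of (orb i)"] sym[of "bar \<alpha>"])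
    next
      case False
      define \<beta> where "\<beta> = s i \<alpha>"
      have \<beta>: "\<beta> \<in> gpos_roots V E"
      proof (cases "\<pi> i = i")
        case True then show ?thesis
          using gpos_roots_r[OF less.prems i(1)] False by (simp add: \<beta>_def s_def)
      next
        case nf: False
        have 1: "r (\<pi> i) \<alpha> \<in> gpos_roots V E" using gpos_roots_r[OF less.prems] i False by simp
        have "r (\<pi> i) \<alpha> \<noteq> frag_of i"
        proof
          assume "r (\<pi> i) \<alpha> = frag_of i"
          then have "\<alpha> = r (\<pi> i) (frag_of i)" using r_r[of "\<pi> i" \<alpha>] i by simp
          also have "\<dots> = frag_of i"
            using nf i pi_not_nbr[of "\<pi> i"] by (simp add: r_frag_of)
          finally show False using False by simp
        qed
        then show ?thesis using gpos_roots_r[OF 1 i(1)] nf by (simp add: \<beta>_def s_def)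
      qed
      have "pairing (act \<pi> \<alpha>) i = pairing \<alpha> (\<pi> i)" by (rule pairing_act[OF lat i(1)])
      then have p: "0 < pairing \<alpha> i + pairing \<alpha> (\<pi> i)" using i by (simp add: pairing_linear)
      have "(\<Sum>k\<in>V. coef \<beta> k) = (\<Sum>k\<in>V. coef \<alpha> k) - (\<Sum>k\<in>orb i. pairing \<alpha> k)"
      proof -
        have "(\<Sum>k\<in>V. if k \<in> orb i then pairing \<alpha> k else 0) = (\<Sum>k\<in>V \<inter> orb i. pairing \<alpha> k)"
          by (simp add: sum.inter_restrict)
        also have "V \<inter> orb i = orb i" using i by (auto simp: vorbit_def)
        finally show ?thesis by (simp add: \<beta>_def lookup_s[OF i(1)] sum_subtractf)
      qed
      moreover have "0 < (\<Sum>k\<in>orb i. pairing \<alpha> k)"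
        using p by (cases "\<pi> i = i") (auto simp: vorbit_def)
      ultimately have "height \<beta> < height \<alpha>"
        using gpos_roots_pos[OF \<beta>] pos by (intro height_less) auto
      then obtain y where y: "y \<in> km_pos_roots Orb A" "\<phi> y = bar \<beta>" using less.hyps \<beta> by blast
      have y_lat: "y \<in> root_lattice Orb" using km_pos_roots_root_lattice[OF y(1)] .
      define z where "z = km_reflection Orb A (orb i) y"
      have z_lat: "z \<in> root_lattice Orb"
        using y_lat i by (simp add: z_def km_reflection_root_lattice)
      have "\<phi> z = s i (s i (bar \<alpha>))"
        using phi_km_reflection[OF y_lat i(1)] y(2) bar_s[OF lat i(1)] by (simp add: z_def \<beta>_def)
      then have z: "\<phi> z = bar \<alpha>" using s_s[OF i(1)] by simp
      then have "z \<in> root_lattice_pos Orb"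
        using z_lat bar_pos[OF pos] by (intro pos_of_phi_pos) auto
      then have "z \<in> km_pos_roots Orb A"
        using km_pos_roots_reflection[OF y(1)] i by (simp add: z_def)
      then show ?thesis using z by blast
    qed
  qed
qed

theorem folded_pos_roots_eq:
  "folded_pos_roots V E \<pi> \<sigma> = {bar \<alpha> | \<alpha>. \<alpha> \<in> gpos_roots V E}"
  unfolding folded_pos_roots_def
proof (intro equalityI subsetI)
  fix x assume "x \<in> \<phi> ` km_pos_roots Orb A"
  then show "x \<in> {bar \<alpha> | \<alpha>. \<alpha> \<in> gpos_roots V E}" using phi_root_is_bar by blast
next
  fix x assume "x \<in> {bar \<alpha> | \<alpha>. \<alpha> \<in> gpos_roots V E}"
  then obtain \<alpha> where \<alpha>: "\<alpha> \<in> gpos_roots V E" "x = bar \<alpha>" by blast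
  obtain y where "y \<in> km_pos_roots Orb A" "\<phi> y = bar \<alpha>" using bar_root_is_phi[OF \<alpha>(1)] by blast
  then show "x \<in> \<phi> ` km_pos_roots Orb A" unfolding \<alpha>(2) by (metis imageI)
qed

end

theorem lemma6p8:
  fixes V :: "'a set" and E :: "'a set set" and \<pi> :: "'a \<Rightarrow> 'a" and \<sigma> :: "'a \<Rightarrow> int"
  assumes "simple_graph V E"
    and "graph_automorphism V E \<pi>"
    and "involutive_on V \<pi>"
    and "admissible E \<pi>"
    and "\<forall>j\<in>fixed_vertices V \<pi>. \<sigma> j \<in> {1, -1}"
  shows "folded_pos_roots V E \<pi> \<sigma> = {symmetrize V \<pi> \<sigma> \<alpha> | \<alpha>. \<alpha> \<in> gpos_roots V E}"
proof -
  interpret folding V E \<pi> \<sigma>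
    using assms by unfold_locales
  show ?thesis by (rule folded_pos_roots_eq)
qed

end
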